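(* Let $\mathrm{d}=(d_1,\dots,d_n)$ and $\mathrm{d}'=(d'_1,\dots,d'_n)$ be degree sequences of length $n$, and let $\mathrm{T}_{\mathrm{d}}$ and $\mathrm{T}_{\mathrm{d}'}$ be uniformly random elements of $\mathcal{T}_{\mathrm{d}}$ and $\mathcal{T}_{\mathrm{d}'}$, respectively. If $\mathrm{d}'\prec_1\mathrm{d}$, then $$\mathrm{ht}(\mathrm{T}_{\mathrm{d}'})\preceq_{\mathrm{st}}\mathrm{ht}(\mathrm{T}_{\mathrm{d}}).$$ Moreover, if $\mathrm{d}'\prec_1\mathrm{d}$ and $\mathrm{d}$ contains at least $3$ non-leaf vertices (i.e. at least three nonzero entries), then the stochastic domination is strict: $\mathrm{ht}(\mathrm{T}_{\mathrm{d}'})\prec_{\mathrm{st}}\mathrm{ht}(\mathrm{T}_{\mathrm{d}})$.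
   Context: A degree sequence is a sequence of non-negative integers $\mathrm{d}=(d_1,\dots,d_n)$ with $\sum_{i=1}^n d_i=n-1$. $\mathcal{T}_{\mathrm{d}}$ is the set of rooted labeled trees with vertex set $[n]=\{1,\dots,n\}$ in which, for each $i$, vertex $i$ has exactly $d_i$ children. The height $\mathrm{ht}$ of a rooted tree is the maximum graph distance from the root to a vertex. For random variables $X,Y$, $X\preceq_{\mathrm{st}}Y$ means $\mathbf{P}(X\le t)\ge\mathbf{P}(Y\le t)$ for all $t\in\mathbb{R}$; $X\prec_{\mathrm{st}}Y$ means $X\preceq_{\mathrm{st}}Y$ and $X,Y$ are not identically distributed. Two degree sequences of length $n$ are equivalent if one is obtained from the other by permuting entries. The partial order $\prec_1$ is defined through the following relation on equivalence classes: for equivalence classes $\mathcal{D},\mathcal{D}'$ of degree sequences of length $n$, say that $\mathcal{D}$ covers $\mathcal{D}'$ if there exist $\mathrm{d}=(d_1,\dots,d_n)\in\mathcal{D}$ and $\mathrm{d}'=(d'_1,\dots,d'_n)\in\mathcal{D}'$ such that $d_1\ge d_2$, $d'_1=d_1+1$, $d'_2=d_2-1$, and $d'_k=d_k$ for $3\le k\le n$. Then $\mathrm{d}'\prec_1\mathrm{d}$ means that there is a finite chain $\mathcal{D}_0,\dots,\mathcal{D}_r$, $r\ge1$, of equivalence classes with $\mathrm{d}\in\mathcal{D}_0$, $\mathrm{d}'\in\mathcal{D}_r$, and $\mathcal{D}_{j-1}$ covering $\mathcal{D}_{j}$ for each $1\le j\le r$, i.e. for each such $j$ there exist $\mathrm{e}=(e_1,\dots,e_n)\in\mathcal{D}_{j-1}$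 and $\mathrm{e}'=(e'_1,\dots,e'_n)\in\mathcal{D}_j$ with $e_1\ge e_2$, $e'_1=e_1+1$, $e'_2=e_2-1$, and $e'_k=e_k$ for $3\le k\le n$. *)

theory Defs
  imports
    "HOL-Probability.Probability"
    "HOL-Combinatorics.List_Permutation"
    "Graph_Theory.Digraph_Component"
begin

text \<open>
  A sequence \<open>(d\<^sub>1, \<dots>, d\<^sub>n)\<close> is a list of length \<open>n\<close>, so \<open>d\<^sub>i\<close> is \<open>d ! (i - 1)\<close>.
  The sum condition is stated without truncated subtraction; in particular it forces \<open>n \<ge> 1\<close>.
\<close>

definition degree_sequences :: "nat \<Rightarrow> nat list set" where
  "degree_sequences n = {d. length d = n \<and> sum_list d + 1 = n}"

definition degree_equiv :: "nat \<Rightarrow> (nat list \<times> nat list) set" where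
  "degree_equiv n = {(d, e). d \<in> degree_sequences n \<and> e \<in> degree_sequences n \<and> d <~~> e}"

lemma equiv_degree_equiv: "equiv (degree_sequences n) (degree_equiv n)"
  by (rule equivI) (auto simp: degree_equiv_def refl_on_def sym_def trans_def)

definition degree_classes :: "nat \<Rightarrow> nat list set set" where
  "degree_classes n = degree_sequences n // degree_equiv n"

definition covers :: "nat \<Rightarrow> nat list set \<Rightarrow> nat list set \<Rightarrow> bool" where
  "covers n D D' \<longleftrightarrow> 2 \<le> n \<and> (\<exists>d\<in>D. \<exists>d'\<in>D'.
     d ! 0 \<ge> d ! 1 \<and> d' ! 0 = d ! 0 + 1 \<and> d' ! 1 + 1 = d ! 1 \<and>
     (\<forall>k. 2 \<le> k \<and> k < n \<longrightarrow> d' ! k = d ! k))"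

definition cover_rel :: "nat \<Rightarrow> (nat list set \<times> nat list set) set" where
  "cover_rel n = {(D, D'). D \<in> degree_classes n \<and> D' \<in> degree_classes n \<and> covers n D D'}"

definition degree_prec :: "nat list \<Rightarrow> nat list \<Rightarrow> bool" (infix \<open>\<prec>\<^sub>1\<close> 50) where
  "d' \<prec>\<^sub>1 d \<longleftrightarrow> (\<exists>D D'. d \<in> D \<and> d' \<in> D' \<and> (D, D') \<in> (cover_rel (length d))\<^sup>+)"

text \<open>
  Undirected simple graphs are symmetric loop-free digraphs (\<open>pair_graph\<close>).  The library predicate
  \<open>tree\<close> is unsuitable for them: it counts the closed walk \<open>u, v, u\<close> along an edge as a cycle.
  Cycles of length at least 3 are exactly the cycles of the undirected graph.
\<close>

definition undirected_tree :: "'a pair_pre_digraph \<Rightarrow> bool" where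
  "undirected_tree G \<longleftrightarrow> pair_graph G \<and> Digraph_Component.connected (with_proj G) \<and>
     \<not> (\<exists>p. pre_digraph.cycle (with_proj G) p \<and> 3 \<le> length p)"

definition graph_dist :: "'a pair_pre_digraph \<Rightarrow> 'a \<Rightarrow> 'a \<Rightarrow> nat" where
  "graph_dist G u v = (LEAST k. \<exists>p. pre_digraph.awalk (with_proj G) u p v \<and> length p = k)"

type_synonym 'a rooted_graph = "'a \<times> 'a pair_pre_digraph"

definition rooted_tree :: "'a rooted_graph \<Rightarrow> bool" where
  "rooted_tree = (\<lambda>(r, G). undirected_tree G \<and> r \<in> pverts G)"

text \<open>The children of \<open>u\<close> are its neighbours one step further away from the root.\<close>

definition children :: "'a rooted_graph \<Rightarrow> 'a \<Rightarrow> 'a set" where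
  "children = (\<lambda>(r, G) u. {v. (u, v) \<in> parcs G \<and> graph_dist G r v = graph_dist G r u + 1})"

definition tree_height :: "'a rooted_graph \<Rightarrow> nat" where
  "tree_height = (\<lambda>(r, G). Max (graph_dist G r ` pverts G))"

definition degree_trees :: "nat list \<Rightarrow> nat rooted_graph set" where
  "degree_trees d = {t. rooted_tree t \<and> pverts (snd t) = {1..length d} \<and>
     (\<forall>i\<in>{1..length d}. card (children t i) = d ! (i - 1))}"

definition uniform_random_element :: "'w measure \<Rightarrow> ('w \<Rightarrow> 'a) \<Rightarrow> 'a set \<Rightarrow> bool" where
  "uniform_random_element M X A \<longleftrightarrow> prob_space M \<and> X \<in> measurable M (count_space A) \<and>
     distr M (count_space A) X = uniform_count_measure A"

definition stoch_le :: "'v measure \<Rightarrow> ('v \<Rightarrow> real) \<Rightarrow> 'w measure \<Rightarrow> ('w \<Rightarrow> real) \<Rightarrow> bool" where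
  "stoch_le M X N Y \<longleftrightarrow>
     (\<forall>t. measure M {x \<in> space M. X x \<le> t} \<ge> measure N {y \<in> space N. Y y \<le> t})"

definition stoch_less :: "'v measure \<Rightarrow> ('v \<Rightarrow> real) \<Rightarrow> 'w measure \<Rightarrow> ('w \<Rightarrow> real) \<Rightarrow> bool" where
  "stoch_less M X N Y \<longleftrightarrow> stoch_le M X N Y \<and> distr M borel X \<noteq> distr N borel Y"

end

theory Submission
  imports Defs "HOL-Combinatorics.Multiset_Permutations"
begin

text \<open>
  Let \<open>d'\<close> arise from \<open>d\<close> by transferring one child from \<open>y\<close> to \<open>x\<close>, where \<open>x\<close> has at least as many
  children as \<open>y\<close>.  Order the children of \<open>x\<close> and of \<open>y\<close>; this multiplies the number of trees of any
  height by a constant depending only on the degrees.  For a tree with degrees \<open>d\<close> and height at most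
  \<open>h\<close>, let \<open>c\<close> be the first child of \<open>y\<close>.  If \<open>x\<close> is not in the subtree of \<open>c\<close> and moving this subtree
  to \<open>x\<close> keeps the height at most \<open>h\<close>, do so.  Otherwise \<open>y\<close> is closer to the root than \<open>x\<close>: exchange
  the labels \<open>x\<close> and \<open>y\<close> and move the surplus children from the lower vertex to the upper one, which
  does not increase the height.  The two kinds of images are told apart by trying to move the first
  child of \<open>x\<close> back to \<open>y\<close>, so the map is injective; for large \<open>h\<close> it is a bijection, so both sides
  have the same total number of trees.  With a third non-leaf, a path through all non-leaves except \<open>y\<close>
  that starts at \<open>x\<close>, with \<open>y\<close> another child of \<open>x\<close>, is not in the image for a suitable \<open>h\<close>.
\<close>

section \<open>Parent maps\<close>

text \<open>The root and all points outside \<open>V\<close> are fixed points, so that iterates of the parent map are total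
  and relabelling is conjugation.\<close>

definition parent_tree :: "'a set \<Rightarrow> 'a \<Rightarrow> ('a \<Rightarrow> 'a) \<Rightarrow> bool" where
  "parent_tree V r p \<longleftrightarrow> r \<in> V \<and> (\<forall>v. v \<notin> V - {r} \<longrightarrow> p v = v) \<and>
     (\<forall>v\<in>V - {r}. p v \<in> V) \<and> (\<forall>v\<in>V. \<exists>k. (p ^^ k) v = r)"

definition depth :: "'a \<Rightarrow> ('a \<Rightarrow> 'a) \<Rightarrow> 'a \<Rightarrow> nat" where
  "depth r p v = (LEAST k. (p ^^ k) v = r)"

definition kids :: "'a set \<Rightarrow> 'a \<Rightarrow> ('a \<Rightarrow> 'a) \<Rightarrow> 'a \<Rightarrow> 'a set" where
  "kids V r p u = {v \<in> V - {r}. p v = u}"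

text \<open>Membership in the union of the subtrees rooted at the points of \<open>X\<close>; with
  \<open>k = 0\<close> a point of \<open>X\<close> belongs to its own subtree.\<close>

definition below :: "('a \<Rightarrow> 'a) \<Rightarrow> 'a set \<Rightarrow> 'a \<Rightarrow> bool" where
  "below p X w \<longleftrightarrow> (\<exists>k. (p ^^ k) w \<in> X)"

text \<open>A whole bundle \<open>X\<close> moves at once because exchanging labels transfers
  several surplus children together. That \<open>x\<close> lies outside the moved subtrees is
  checked where the map is applied.\<close>

definition reattach :: "'a \<Rightarrow> 'a set \<Rightarrow> ('a \<Rightarrow> 'a) \<Rightarrow> 'a \<Rightarrow> 'a" where
  "reattach x X p = (\<lambda>w. if w \<in> X then x else p w)"

lemma parent_treeD:
  assumes "parent_tree V r p"
  shows "r \<in> V" "p r = r" "v \<notin> V \<Longrightarrow> p v = v" "v \<in> V \<Longrightarrow> p v \<in> V"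
  using assms unfolding parent_tree_def by (blast, blast, blast, metis Diff_iff singletonD)

lemma depth_root [simp]: "depth r p r = 0"
  unfolding depth_def by (rule Least_eq_0) simp

lemma depth_step:
  assumes "parent_tree V r p" "v \<in> V" "v \<noteq> r"
  shows "depth r p v = Suc (depth r p (p v))"
proof -
  obtain k where "(p ^^ k) v = r"
    using assms unfolding parent_tree_def by blast
  then have "(LEAST k. (p ^^ k) v = r) = Suc (LEAST k. (p ^^ Suc k) v = r)"
    using assms by (intro Least_Suc) auto
  then show ?thesis
    unfolding depth_def by (simp add: funpow_swap1)
qed

lemma parent_tree_induct [consumes 2, case_names root step]:
  assumes "parent_tree V r p" "w \<in> V"
    and "P r" and "\<And>v. v \<in> V \<Longrightarrow> v \<noteq> r \<Longrightarrow> P (p v) \<Longrightarrow> P v"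
  shows "P w"
  using assms(2)
proof (induction "depth r p w" arbitrary: w rule: less_induct)
  case less
  then show ?case
    using depth_step[OF assms(1), of w] parent_treeD[OF assms(1)] assms(3,4) by (cases "w = r") auto
qed

text \<open>A potential that drops by one with each step to the parent excludes cycles, so iterating
  \<open>p\<close> can only end at \<open>r\<close>.\<close>

lemma parent_treeI:
  fixes D :: "'a \<Rightarrow> nat"
  assumes "r \<in> V" "\<And>v. v \<notin> V - {r} \<Longrightarrow> p v = v"
    and pV: "\<And>v. v \<in> V \<Longrightarrow> v \<noteq> r \<Longrightarrow> p v \<in> V"
    and D: "\<And>v. v \<in> V \<Longrightarrow> v \<noteq> r \<Longrightarrow> D v = Suc (D (p v))"
  shows "parent_tree V r p"
proof -
  have "\<exists>k. (p ^^ k) v = r" if "v \<in> V" for v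
    using that
  proof (induction "D v" arbitrary: v rule: less_induct)
    case less
    show ?case
    proof (cases "v = r")
      case True
      then have "(p ^^ 0) v = r" by simp
      then show ?thesis ..
    next
      case False
      then obtain k where "(p ^^ k) (p v) = r"
        using less.hyps[of "p v"] pV[of v] D[of v] less.prems by auto
      then have "(p ^^ Suc k) v = r"
        by (simp add: funpow_swap1)
      then show ?thesis ..
    qed
  qed
  with assms show ?thesis
    unfolding parent_tree_def by blast
qed

text \<open>The recursion along parents determines the depth, so depths in a modified tree can be
  guessed and then checked one step at a time.\<close>

lemma depth_unique:
  assumes "parent_tree V r p" "v \<in> V" "D r = 0"
    and "\<And>v. v \<in> V \<Longrightarrow> v \<noteq> r \<Longrightarrow> D v = Suc (D (p v))"
  shows "depth r p v = D v"
  using assms(1,2)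
  by (induction rule: parent_tree_induct) (auto simp: assms(3,4) depth_step[OF assms(1)])

lemma kidsD:
  "v \<in> kids V r p u \<Longrightarrow> v \<in> V" "v \<in> kids V r p u \<Longrightarrow> v \<noteq> r" "v \<in> kids V r p u \<Longrightarrow> p v = u"
  by (auto simp: kids_def)

lemma depth_kid:
  assumes "parent_tree V r p" "v \<in> kids V r p u"
  shows "depth r p v = Suc (depth r p u)"
  using depth_step[OF assms(1)] kidsD[OF assms(2)] by auto

section \<open>Subtrees and ancestors\<close>

lemma below_iff: "below p X w \<longleftrightarrow> w \<in> X \<or> below p X (p w)"
proof
  assume "below p X w"
  then obtain k where k: "(p ^^ k) w \<in> X"
    unfolding below_def by blast
  show "w \<in> X \<or> below p X (p w)"
  proof (cases k)
    case (Suc j)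
    then have "(p ^^ j) (p w) \<in> X"
      using k by (simp add: funpow_swap1)
    then show ?thesis
      unfolding below_def by blast
  qed (use k in simp)
next
  assume "w \<in> X \<or> below p X (p w)"
  then show "below p X w"
  proof
    assume "w \<in> X"
    then have "(p ^^ 0) w \<in> X" by simp
    then show ?thesis unfolding below_def ..
  next
    assume "below p X (p w)"
    then obtain k where "(p ^^ Suc k) w \<in> X"
      unfolding below_def by (auto simp: funpow_swap1)
    then show ?thesis unfolding below_def ..
  qed
qed

lemma below_root:
  assumes "parent_tree V r p" "r \<notin> X"
  shows "\<not> below p X r"
proof -
  have "(p ^^ k) r = r" for k
    by (induction k) (auto simp: parent_treeD[OF assms(1)])
  then show ?thesis
    unfolding below_def using assms by auto
qed

lemma below_depth:
  assumes "parent_tree V r p" "w \<in> V" "below p X w"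
  shows "\<exists>z\<in>X \<inter> V. depth r p z \<le> depth r p w"
  using assms
proof (induction rule: parent_tree_induct)
  case root
  then have "r \<in> X"
    using below_root[OF assms(1)] by blast
  then have "r \<in> X \<inter> V"
    using parent_treeD[OF assms(1)] by blast
  then show ?case by force
next
  case (step v)
  show ?case
  proof (cases "v \<in> X")
    case True
    then show ?thesis using step.hyps by blast
  next
    case False
    then obtain z where "z \<in> X \<inter> V" "depth r p z \<le> depth r p (p v)"
      using step below_iff[of p X v] by blast
    then show ?thesis
      using depth_step[OF assms(1) step.hyps] by (intro bexI[of _ z]) auto
  qed
qed

text \<open>Mostly used in contraposition: a vertex no deeper than \<open>y\<close> is not below
  children of \<open>y\<close>, so these may be hung under it without closing a cycle.\<close>

lemma below_kids_depth:
  assumes "parent_tree V r p" "w \<in> V" "below p X w" "X \<subseteq> kids V r p y"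
  shows "depth r p y < depth r p w"
  using below_depth[OF assms(1-3)] assms(4) depth_kid[OF assms(1)] by fastforce

text \<open>Go from \<open>w\<close> towards the root up to the first point of \<open>X\<close> or
  \<open>Y\<close>. If it is in \<open>X\<close>, its parent \<open>x\<close> is not below
  \<open>Y\<close>, so the point itself must be in \<open>Y\<close>; the other case is symmetric.
  With \<open>x = y\<close> this separates the subtrees of distinct children of one vertex.\<close>

lemma below_disjoint:
  assumes t: "parent_tree V r p" and w: "w \<in> V" and "below p X w" "below p Y w"
    and X: "X \<subseteq> kids V r p x" "\<not> below p X y" and Y: "Y \<subseteq> kids V r p y" "\<not> below p Y x"
  shows "X \<inter> Y \<noteq> {}"
  using t w assms(3,4)
proof (induction rule: parent_tree_induct)
  case root
  then show ?case using below_root[OF t, of X] X by (auto simp: kids_def)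
next
  case (step v)
  have "\<not> (v \<in> X \<and> below p Y (p v))" "\<not> (v \<in> Y \<and> below p X (p v))"
    using X Y by (auto simp: kids_def)
  then show ?case
    using step below_iff[of p X v] below_iff[of p Y v] by blast
qed

section \<open>Moving subtrees to another vertex\<close>

lemma funpow_reattach:
  assumes "\<not> below p X w"
  shows "(reattach x X p ^^ k) w = (p ^^ k) w"
proof (induction k)
  case (Suc k)
  with assms show ?case by (auto simp: reattach_def below_def)
qed simp

lemma below_reattach_cong: "\<not> below p X w \<Longrightarrow> below (reattach x X p) Y w \<longleftrightarrow> below p Y w"
  by (simp add: below_def funpow_reattach)

text \<open>A path towards the root is altered only after it has reached \<open>X\<close>, so the
  set of moved vertices is the same before and after.\<close>

lemma below_reattach:
  assumes t: "parent_tree V r p" and r: "r \<notin> X" and x: "x \<in> V" "\<not> below p X x" and w: "w \<in> V"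
  shows "below (reattach x X p) X w \<longleftrightarrow> below p X w"
  using t w
proof (induction rule: parent_tree_induct)
  case root
  then show ?case using below_reattach_cong below_root[OF t r] by metis
next
  case (step v)
  show ?case
  proof (cases "v \<in> X")
    case True
    then show ?thesis by (auto intro: below_iff[THEN iffD2])
  next
    case False
    then show ?thesis
      using step.IH by (subst (1 2) below_iff) (simp add: reattach_def)
  qed
qed

text \<open>The moved subtrees shift rigidly by the difference of the depths of \<open>x\<close> and
  \<open>y\<close>. Taking the shifted depth as potential shows at once that the result is a tree
  and what its depths are.\<close>

lemma
  assumes t: "parent_tree V r p" and X: "X \<subseteq> kids V r p y" and x: "x \<in> V" "\<not> below p X x"
  shows parent_tree_reattach: "parent_tree V r (reattach x X p)"
    and depth_reattach: "w \<in> V \<Longrightarrow> depth r (reattach x X p) w =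
      (if below p X w then depth r p w + depth r p x - depth r p y else depth r p w)"
proof -
  define D where "D w = (if below p X w then depth r p w + depth r p x - depth r p y else depth r p w)" for w
  have r: "r \<notin> X" using X by (auto simp: kids_def)
  have step: "D v = Suc (D (reattach x X p v))" if v: "v \<in> V" "v \<noteq> r" for v
  proof (cases "v \<in> X")
    case True
    then have "below p X v" "p v = y"
      using X by (auto simp: kids_def intro: below_iff[THEN iffD2])
    then show ?thesis
      using True x depth_step[OF t v] by (simp add: D_def reattach_def)
  next
    case False
    then have "below p X v \<longleftrightarrow> below p X (p v)"
      by (subst below_iff) simp
    \<comment> \<open>The truncated subtraction is exact because every vertex below \<open>X\<close>
      is deeper than \<open>y\<close>.\<close>
    moreover have "Suc (depth r p (p v)) + depth r p x - depth r p y =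
        Suc (depth r p (p v) + depth r p x - depth r p y)" if "below p X (p v)"
      using below_kids_depth[OF t _ that X] parent_treeD(4)[OF t] v by fastforce
    ultimately show ?thesis
      using False depth_step[OF t v] by (simp add: D_def reattach_def)
  qed
  show t': "parent_tree V r (reattach x X p)"
  proof (rule parent_treeI[where D = D])
    show "reattach x X p v = v" if "v \<notin> V - {r}" for v
      using that X parent_treeD[OF t] by (auto simp: reattach_def kids_def)
    show "reattach x X p v \<in> V" if "v \<in> V" "v \<noteq> r" for v
      using that x parent_treeD[OF t] by (auto simp: reattach_def)
  qed (use step parent_treeD[OF t] in auto)
  show "depth r (reattach x X p) w =
      (if below p X w then depth r p w + depth r p x - depth r p y else depth r p w)" if "w \<in> V"
  proof -
    have "D r = 0" using below_root[OF t r] by (simp add: D_def)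
    from depth_unique[OF t' that this step] show ?thesis by (simp add: D_def)
  qed
qed

lemma kids_reattach:
  assumes "X \<subseteq> kids V r p y" "x \<noteq> y"
  shows "kids V r (reattach x X p) u =
    (if u = x then kids V r p x \<union> X else if u = y then kids V r p y - X else kids V r p u)"
  using assms by (auto simp: kids_def reattach_def)

lemma reattach_reattach:
  assumes "X \<subseteq> kids V r p y"
  shows "reattach y X (reattach x X p) = p"
  using assms by (auto simp: kids_def reattach_def fun_eq_iff)

section \<open>Conjugation of parent maps by permutations\<close>

definition relabel :: "('a \<Rightarrow> 'a) \<Rightarrow> ('a \<Rightarrow> 'a) \<Rightarrow> 'a \<Rightarrow> 'a" where
  "relabel \<pi> p = \<pi> \<circ> p \<circ> inv \<pi>"

context
  fixes \<pi> :: "'a \<Rightarrow> 'a" and V :: "'a set"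
  assumes \<pi>: "\<pi> permutes V"
begin

lemma relabel_apply [simp]: "relabel \<pi> p (\<pi> v) = \<pi> (p v)"
  using permutes_inverses[OF \<pi>] by (simp add: relabel_def)

lemma funpow_relabel: "(relabel \<pi> p ^^ k) (\<pi> v) = \<pi> ((p ^^ k) v)"
  by (induction k) auto

lemma depth_relabel: "depth (\<pi> r) (relabel \<pi> p) (\<pi> v) = depth r p v"
  unfolding depth_def funpow_relabel using permutes_inj[OF \<pi>] by (simp add: inj_eq)

lemma below_relabel: "below (relabel \<pi> p) (\<pi> ` X) (\<pi> v) \<longleftrightarrow> below p X v"
  unfolding below_def funpow_relabel using permutes_inj[OF \<pi>] by (simp add: inj_image_mem_iff)

lemma parent_tree_relabel:
  assumes t: "parent_tree V r p"
  shows "parent_tree V (\<pi> r) (relabel \<pi> p)"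
proof -
  have surj: "\<exists>w. v = \<pi> w" for v
    using permutes_surj[OF \<pi>] by (metis surjD)
  have inj: "\<pi> v = \<pi> w \<longleftrightarrow> v = w" for v w
    using permutes_inj[OF \<pi>] by (simp add: inj_eq)
  have mem: "\<pi> v \<in> V \<longleftrightarrow> v \<in> V" for v
    using \<pi> by (simp add: permutes_in_image)
  show ?thesis
    unfolding parent_tree_def
  proof (intro conjI ballI allI impI)
    show "\<pi> r \<in> V" using parent_treeD[OF t] mem by simp
  next
    fix v assume v: "v \<notin> V - {\<pi> r}"
    obtain w where "v = \<pi> w" using surj by blast
    then show "relabel \<pi> p v = v"
      using v parent_treeD[OF t] by (auto simp: mem inj)
  next
    fix v assume v: "v \<in> V - {\<pi> r}"
    obtain w where "v = \<pi> w" using surj by blast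
    then show "relabel \<pi> p v \<in> V"
      using v parent_treeD[OF t] by (auto simp: mem inj)
  next
    fix v assume v: "v \<in> V"
    obtain w where w: "v = \<pi> w" using surj by blast
    then obtain k where "(p ^^ k) w = r"
      using v t unfolding parent_tree_def by (auto simp: mem)
    then show "\<exists>k. (relabel \<pi> p ^^ k) v = \<pi> r"
      by (auto simp: w funpow_relabel)
  qed
qed

lemma kids_relabel: "kids V (\<pi> r) (relabel \<pi> p) (\<pi> u) = \<pi> ` kids V r p u"
proof -
  have "v \<in> kids V (\<pi> r) (relabel \<pi> p) (\<pi> u) \<longleftrightarrow> v \<in> \<pi> ` kids V r p u" for v
  proof -
    obtain w where w: "v = \<pi> w"
      using permutes_surj[OF \<pi>] by (metis surjD)
    show ?thesis
      unfolding w using permutes_inj[OF \<pi>] \<pi>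
      by (simp add: kids_def inj_image_mem_iff permutes_in_image inj_eq)
  qed
  then show ?thesis by blast
qed

lemma relabel_inv: "relabel (inv \<pi>) (relabel \<pi> p) = p"
  using permutes_inverses[OF \<pi>] permutes_inv_inv[OF \<pi>] by (simp add: relabel_def fun_eq_iff)

end

section \<open>Transferring a child\<close>

definition height_le :: "'a set \<Rightarrow> nat \<Rightarrow> 'a \<times> ('a \<Rightarrow> 'a) \<Rightarrow> bool" where
  "height_le V h = (\<lambda>(r, p). \<forall>v\<in>V. depth r p v \<le> h)"

definition parent_trees :: "'a set \<Rightarrow> ('a \<Rightarrow> nat) \<Rightarrow> ('a \<times> ('a \<Rightarrow> 'a)) set" where
  "parent_trees V deg = {(r, p). parent_tree V r p \<and> (\<forall>u\<in>V. card (kids V r p u) = deg u)}"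

type_synonym 'a ordered_tree = "('a \<times> ('a \<Rightarrow> 'a)) \<times> 'a list \<times> 'a list"

text \<open>The orders turn the first child of \<open>y\<close> and the surplus children of
  \<open>x\<close> into canonical choices.\<close>

definition ordered_trees :: "'a set \<Rightarrow> 'a \<Rightarrow> 'a \<Rightarrow> ('a \<Rightarrow> nat) \<Rightarrow> 'a ordered_tree set" where
  "ordered_trees V x y deg = (SIGMA t : parent_trees V deg.
     permutations_of_set (kids V (fst t) (snd t) x) \<times> permutations_of_set (kids V (fst t) (snd t) y))"

definition low_ordered_trees :: "'a set \<Rightarrow> 'a \<Rightarrow> 'a \<Rightarrow> ('a \<Rightarrow> nat) \<Rightarrow> nat \<Rightarrow> 'a ordered_tree set" where
  "low_ordered_trees V x y deg h = {t \<in> ordered_trees V x y deg. height_le V h (fst t)}"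

lemma finite_kids: "finite V \<Longrightarrow> finite (kids V r p u)"
  unfolding kids_def by simp

text \<open>\<open>b\<close> is the number of children that \<open>y\<close> keeps, so no
  predecessor of \<open>deg y\<close> is needed; \<open>b < deg x\<close> says that \<open>x\<close>
  has at least as many children as \<open>y\<close>.\<close>

locale transfer_child =
  fixes V :: "'a set" and x y :: 'a and deg :: "'a \<Rightarrow> nat" and b :: nat
  assumes finite_V: "finite V" and x: "x \<in> V" and y: "y \<in> V" and x_neq_y: "x \<noteq> y"
    and deg_y: "deg y = Suc b" and deg_x: "b < deg x"
begin

abbreviation "deg' \<equiv> deg(x := Suc (deg x), y := b)"
abbreviation "\<tau> \<equiv> Transposition.transpose x y"

lemma \<tau>: "\<tau> permutes V"
  using x y by (rule permutes_swap_id)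

definition move :: "'a ordered_tree \<Rightarrow> 'a ordered_tree" where
  "move = (\<lambda>((r, p), K, L). ((r, reattach x {hd L} p), hd L # K, tl L))"

definition unmove :: "'a ordered_tree \<Rightarrow> 'a ordered_tree" where
  "unmove = (\<lambda>((r, p), K, L). ((r, reattach y {hd K} p), tl K, hd K # L))"

text \<open>After relabelling, \<open>x\<close> has \<open>Suc b\<close> children and
  \<open>y\<close> has \<open>deg x\<close>. Leaving \<open>b\<close> of them at \<open>y\<close>
  and passing the rest to \<open>x\<close> yields the degrees \<open>deg'\<close>. The bundle passed
  on starts at position \<open>Suc b\<close> of the new list of \<open>x\<close>, where
  \<open>unswap\<close> finds it.\<close>

definition swap :: "'a ordered_tree \<Rightarrow> 'a ordered_tree" where
  "swap = (\<lambda>((r, p), K, L). ((\<tau> r, reattach x (set (drop b (map \<tau> K))) (relabel \<tau> p)),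
     map \<tau> L @ drop b (map \<tau> K), take b (map \<tau> K)))"

definition unswap :: "'a ordered_tree \<Rightarrow> 'a ordered_tree" where
  "unswap = (\<lambda>((r, p), K, L). ((\<tau> r, relabel \<tau> (reattach y (set (drop (Suc b) K)) p)),
     map \<tau> (L @ drop (Suc b) K), map \<tau> (take (Suc b) K)))"

definition movable :: "nat \<Rightarrow> 'a ordered_tree \<Rightarrow> bool" where
  "movable h = (\<lambda>((r, p), K, L). \<not> below p {hd L} x \<and> height_le V h (r, reattach x {hd L} p))"

definition returnable :: "nat \<Rightarrow> 'a ordered_tree \<Rightarrow> bool" where
  "returnable h = (\<lambda>((r, p), K, L). \<not> below p {hd K} y \<and> height_le V h (r, reattach y {hd K} p))"

definition transfer :: "nat \<Rightarrow> 'a ordered_tree \<Rightarrow> 'a ordered_tree" where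
  "transfer h t = (if movable h t then move t else swap t)"

lemma ordered_treesD:
  assumes "((r, p), K, L) \<in> ordered_trees V x y g"
  shows "parent_tree V r p" "u \<in> V \<Longrightarrow> card (kids V r p u) = g u"
    "distinct K" "set K = kids V r p x" "length K = g x"
    "distinct L" "set L = kids V r p y" "length L = g y"
  using assms x y
  by (auto simp: ordered_trees_def parent_trees_def permutations_of_set_def simp flip: distinct_card)

lemma ordered_treesI:
  assumes "parent_tree V r p" "\<And>u. u \<in> V \<Longrightarrow> u \<noteq> x \<Longrightarrow> u \<noteq> y \<Longrightarrow> card (kids V r p u) = g u"
    "distinct K" "set K = kids V r p x" "length K = g x"
    "distinct L" "set L = kids V r p y" "length L = g y"
  shows "((r, p), K, L) \<in> ordered_trees V x y g"
proof -
  have "card (kids V r p u) = g u" if "u \<in> V" for u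
    using assms that distinct_card[of K] distinct_card[of L] by (cases "u = x"; cases "u = y") auto
  with assms show ?thesis
    by (auto simp: ordered_trees_def parent_trees_def permutations_of_set_def)
qed

lemma hd_kids:
  assumes "((r, p), K, L) \<in> ordered_trees V x y deg"
  shows "L \<noteq> []" "hd L \<in> kids V r p y" "L = hd L # tl L"
  using ordered_treesD[OF assms] deg_y by (cases L; auto)+

lemma hd_kids':
  assumes "((r, p), K, L) \<in> ordered_trees V x y deg'"
  shows "K \<noteq> []" "hd K \<in> kids V r p x" "K = hd K # tl K"
  using ordered_treesD[OF assms] x_neq_y by (cases K; auto)+

lemma not_below_own_kids:
  assumes "parent_tree V r p" "X \<subseteq> kids V r p u" "u \<in> V"
  shows "\<not> below p X u"
  using below_kids_depth[OF assms(1,3) _ assms(2)] by auto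

section \<open>Moving the first child from one vertex to the other and back\<close>

text \<open>The second part says that the moved child can be returned without closing a cycle, which
  is one half of \<open>returnable\<close>.\<close>

lemma move_in:
  assumes A: "((r, p), K, L) \<in> ordered_trees V x y deg" and nb: "\<not> below p {hd L} x"
  shows "move ((r, p), K, L) \<in> ordered_trees V x y deg'"
    and "\<not> below (reattach x {hd L} p) {hd L} y"
    and "unmove (move ((r, p), K, L)) = ((r, p), K, L)"
proof -
  note D = ordered_treesD[OF A] and H = hd_kids[OF A]
  have c: "{hd L} \<subseteq> kids V r p y" using H by simp
  have k: "kids V r (reattach x {hd L} p) u = (if u = x then kids V r p x \<union> {hd L}
      else if u = y then kids V r p y - {hd L} else kids V r p u)" for u
    by (rule kids_reattach[OF c x_neq_y])
  have hK: "hd L \<notin> set K" using H D(4) x_neq_y by (auto simp: kids_def)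
  obtain c' L' where L: "L = c' # L'" using H(1) by (cases L) auto
  show "move ((r, p), K, L) \<in> ordered_trees V x y deg'"
    unfolding move_def prod.case
  proof (rule ordered_treesI)
    show "parent_tree V r (reattach x {hd L} p)"
      by (rule parent_tree_reattach[OF D(1) c x nb])
    show "set (tl L) = kids V r (reattach x {hd L} p) y"
      using D(6,7) x_neq_y unfolding k by (auto simp: L)
    show "length (tl L) = deg' y" using D(8) deg_y by simp
  qed (use D hK x_neq_y in \<open>auto simp: k distinct_tl\<close>)
  have "hd L \<noteq> r" using H by (auto simp: kids_def)
  then show "\<not> below (reattach x {hd L} p) {hd L} y"
    using below_reattach[OF D(1) _ x nb y] not_below_own_kids[OF D(1) c y] by simp
  show "unmove (move ((r, p), K, L)) = ((r, p), K, L)"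
    using reattach_reattach[OF c] H by (simp add: move_def unmove_def)
qed

lemma unmove_in:
  assumes B: "((r, p), K, L) \<in> ordered_trees V x y deg'" and nb: "\<not> below p {hd K} y"
  shows "unmove ((r, p), K, L) \<in> ordered_trees V x y deg"
    and "\<not> below (reattach y {hd K} p) {hd K} x"
    and "move (unmove ((r, p), K, L)) = ((r, p), K, L)"
proof -
  note D = ordered_treesD[OF B] and H = hd_kids'[OF B]
  have c: "{hd K} \<subseteq> kids V r p x" using H by simp
  have k: "kids V r (reattach y {hd K} p) u = (if u = y then kids V r p y \<union> {hd K}
      else if u = x then kids V r p x - {hd K} else kids V r p u)" for u
    by (rule kids_reattach[OF c x_neq_y[symmetric]])
  have hL: "hd K \<notin> set L" using H D(7) x_neq_y by (auto simp: kids_def)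
  obtain c' K' where K: "K = c' # K'" using H(1) by (cases K) auto
  show "unmove ((r, p), K, L) \<in> ordered_trees V x y deg"
    unfolding unmove_def prod.case
  proof (rule ordered_treesI)
    show "parent_tree V r (reattach y {hd K} p)"
      by (rule parent_tree_reattach[OF D(1) c y nb])
    show "set (tl K) = kids V r (reattach y {hd K} p) x"
      using D(3,4) x_neq_y unfolding k by (auto simp: K)
    show "length (tl K) = deg x" using D(5) x_neq_y by simp
  qed (use D hL x_neq_y deg_y in \<open>auto simp: k distinct_tl\<close>)
  have "hd K \<noteq> r" using H by (auto simp: kids_def)
  then show "\<not> below (reattach y {hd K} p) {hd K} x"
    using below_reattach[OF D(1) _ y nb x] not_below_own_kids[OF D(1) c x] by simp
  show "move (unmove ((r, p), K, L)) = ((r, p), K, L)"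
    using reattach_reattach[OF c] H by (simp add: move_def unmove_def)
qed

section \<open>Exchanging the two labels and passing on the surplus children\<close>

lemma relabel_facts:
  assumes t: "parent_tree V r p"
  shows "parent_tree V (\<tau> r) (relabel \<tau> p)"
    "depth (\<tau> r) (relabel \<tau> p) x = depth r p y" "depth (\<tau> r) (relabel \<tau> p) y = depth r p x"
    "depth (\<tau> r) (relabel \<tau> p) (\<tau> w) = depth r p w"
    "kids V (\<tau> r) (relabel \<tau> p) x = \<tau> ` kids V r p y" "kids V (\<tau> r) (relabel \<tau> p) y = \<tau> ` kids V r p x"
    "u \<noteq> x \<Longrightarrow> u \<noteq> y \<Longrightarrow> card (kids V (\<tau> r) (relabel \<tau> p) u) = card (kids V r p u)"
    "relabel \<tau> (relabel \<tau> p) = p" "below (relabel \<tau> p) (\<tau> ` X) (\<tau> w) \<longleftrightarrow> below p X w"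
proof -
  show "parent_tree V (\<tau> r) (relabel \<tau> p)" by (rule parent_tree_relabel[OF \<tau> t])
  show "depth (\<tau> r) (relabel \<tau> p) x = depth r p y" "depth (\<tau> r) (relabel \<tau> p) y = depth r p x"
    "depth (\<tau> r) (relabel \<tau> p) (\<tau> w) = depth r p w"
    using depth_relabel[OF \<tau>, of r p x] depth_relabel[OF \<tau>, of r p y] depth_relabel[OF \<tau>, of r p w]
    by simp_all
  show "kids V (\<tau> r) (relabel \<tau> p) x = \<tau> ` kids V r p y" "kids V (\<tau> r) (relabel \<tau> p) y = \<tau> ` kids V r p x"
    using kids_relabel[OF \<tau>, of r p x] kids_relabel[OF \<tau>, of r p y] by simp_all
  show "card (kids V (\<tau> r) (relabel \<tau> p) u) = card (kids V r p u)" if "u \<noteq> x" "u \<noteq> y"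
    using kids_relabel[OF \<tau>, of r p u] that by (simp add: card_image transpose_apply_other)
  show "relabel \<tau> (relabel \<tau> p) = p" using relabel_inv[OF \<tau>, of p] by simp
  show "below (relabel \<tau> p) (\<tau> ` X) (\<tau> w) \<longleftrightarrow> below p X w"
    by (rule below_relabel[OF \<tau>])
qed

lemma unswap_swap:
  assumes A: "((r, p), K, L) \<in> ordered_trees V x y deg"
  shows "unswap (swap ((r, p), K, L)) = ((r, p), K, L)"
proof -
  note D = ordered_treesD[OF A] and R = relabel_facts[OF ordered_treesD(1)[OF A]]
  have X: "set (drop b (map \<tau> K)) \<subseteq> kids V (\<tau> r) (relabel \<tau> p) y"
    using set_drop_subset[of b "map \<tau> K"] D(4) R(6) by simp
  have [simp]: "map \<tau> (map \<tau> zs) = zs" for zs :: "'a list" by (simp add: comp_def)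
  have "map \<tau> (take b (map \<tau> K)) @ map \<tau> (drop b (map \<tau> K)) = K"
    by (simp flip: map_append del: map_map)
  then show ?thesis
    using reattach_reattach[OF X] D(8) R(8) deg_y
    by (simp add: swap_def unswap_def del: map_map)
qed

text \<open>Since \<open>y\<close> was closer to the root, the relabelled tree has \<open>x\<close>
  at the smaller depth. The surplus subtrees move from \<open>y\<close> up to \<open>x\<close>,
  which closes no cycle, increases no depth and leaves everything outside them in place. That
  \<open>y\<close> is not below the surplus children afterwards later excludes certain trees from
  the image.\<close>

lemma swap_in:
  assumes A: "((r, p), K, L) \<in> ordered_trees V x y deg" and d: "depth r p y < depth r p x"
  defines "X \<equiv> set (drop b (map \<tau> K))" and "q \<equiv> relabel \<tau> p"
  shows "swap ((r, p), K, L) \<in> ordered_trees V x y deg'"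
    and "X \<subseteq> kids V (\<tau> r) q y" and "\<not> below q X x" and "\<not> below q X y"
    and "\<not> below (reattach x X q) X y"
    and "w \<in> V \<Longrightarrow> depth (\<tau> r) (reattach x X q) w \<le> depth (\<tau> r) q w"
    and "w \<in> V \<Longrightarrow> \<not> below q X w \<Longrightarrow> depth (\<tau> r) (reattach x X q) w = depth (\<tau> r) q w"
proof -
  note D = ordered_treesD[OF A]
  note R = relabel_facts[OF D(1), folded q_def]
  show X: "X \<subseteq> kids V (\<tau> r) q y"
    using set_drop_subset[of b "map \<tau> K"] D(4) R(6) by (simp add: X_def)
  show nb: "\<not> below q X x"
    using below_kids_depth[OF R(1) x _ X] d R(2,3) by auto
  show nby: "\<not> below q X y"
    by (rule not_below_own_kids[OF R(1) X y])
  have "\<tau> r \<notin> X" using X by (auto simp: kids_def)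
  from below_reattach[OF R(1) this x nb y] nby show "\<not> below (reattach x X q) X y" by simp
  show "depth (\<tau> r) (reattach x X q) w = depth (\<tau> r) q w" if "w \<in> V" "\<not> below q X w"
    using depth_reattach[OF R(1) X x nb that(1)] that by simp
  show "depth (\<tau> r) (reattach x X q) w \<le> depth (\<tau> r) q w" if "w \<in> V"
    using depth_reattach[OF R(1) X x nb that] d R(2,3) by auto
  have k: "kids V (\<tau> r) (reattach x X q) u = (if u = x then kids V (\<tau> r) q x \<union> X
      else if u = y then kids V (\<tau> r) q y - X else kids V (\<tau> r) q u)" for u
    by (rule kids_reattach[OF X x_neq_y])
  have dK: "distinct (map \<tau> K)" "distinct (map \<tau> L)"
    using D(3,6) by (simp_all add: distinct_map)
  have disj: "kids V (\<tau> r) q x \<inter> X = {}"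
    using X x_neq_y by (auto simp: kids_def)
  have sK: "set (map \<tau> K) = kids V (\<tau> r) q y" using D(4) R(6) by simp
  show "swap ((r, p), K, L) \<in> ordered_trees V x y deg'"
    unfolding swap_def prod.case q_def[symmetric] X_def[symmetric]
  proof (rule ordered_treesI)
    show "parent_tree V (\<tau> r) (reattach x X q)"
      by (rule parent_tree_reattach[OF R(1) X x nb])
    show "distinct (map \<tau> L @ drop b (map \<tau> K))"
      using dK disj D(7) R(5) by (simp add: X_def distinct_drop)
    show "set (map \<tau> L @ drop b (map \<tau> K)) = kids V (\<tau> r) (reattach x X q) x"
      using D(7) R(5) unfolding k by (simp add: X_def)
    show "length (map \<tau> L @ drop b (map \<tau> K)) = deg' x"
      using D(5,8) x_neq_y deg_y deg_x by simp
    show "distinct (take b (map \<tau> K))"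
      using dK(1) by (rule distinct_take)
    have "set (take b (map \<tau> K)) = set (map \<tau> K) - X"
      using dK(1) by (metis X_def append_take_drop_id distinct_append Diff_cancel Int_commute
          Diff_triv Un_Diff set_append Un_empty_right)
    then show "set (take b (map \<tau> K)) = kids V (\<tau> r) (reattach x X q) y"
      using sK x_neq_y by (simp add: k)
    show "length (take b (map \<tau> K)) = deg' y"
      using D(5) deg_x by simp
  qed (use R(7) D(2) in \<open>auto simp: k\<close>)
qed

section \<open>The combined map and its injectivity\<close>

text \<open>A failed move has two possible causes, and each puts \<open>y\<close> closer to the
  root: either \<open>x\<close> lies below a child of \<open>y\<close>, or some depth grew beyond
  \<open>h\<close>, which happens only if the moved subtree went down.\<close>

lemma movable_or_depth:
  assumes A: "((r, p), K, L) \<in> ordered_trees V x y deg" and h: "height_le V h (r, p)"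
    and nm: "\<not> movable h ((r, p), K, L)"
  shows "depth r p y < depth r p x"
proof -
  note D = ordered_treesD[OF A] and H = hd_kids[OF A]
  have c: "{hd L} \<subseteq> kids V r p y" using H by simp
  show ?thesis
  proof (cases "below p {hd L} x")
    case True
    then show ?thesis by (rule below_kids_depth[OF D(1) x _ c])
  next
    case False
    then obtain w where w: "w \<in> V" "h < depth r (reattach x {hd L} p) w"
      using nm by (auto simp: movable_def height_le_def not_le)
    moreover have "depth r p w \<le> h"
      using h w by (auto simp: height_le_def)
    ultimately show ?thesis
      using depth_reattach[OF D(1) c x False w(1)] by (auto split: if_splits)
  qed
qed

text \<open>In the swapped tree \<open>x\<close> and \<open>y\<close> have exchanged their depths.
  Returning \<open>\<tau> c\<close> from \<open>x\<close> to \<open>y\<close> there shifts its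
  subtree exactly as moving \<open>c\<close> from \<open>y\<close> to \<open>x\<close> would in the
  original tree, so the bound \<open>h\<close> carries over from one to the other.\<close>

lemma returnable_swap:
  assumes A: "((r, p), K, L) \<in> ordered_trees V x y deg" and h: "height_le V h (r, p)"
    and d: "depth r p y < depth r p x" and um: "returnable h (swap ((r, p), K, L))"
  shows "movable h ((r, p), K, L)"
proof -
  define X q where "X = set (drop b (map \<tau> K))" and "q = relabel \<tau> p"
  define c where "c = hd L"
  note D = ordered_treesD[OF A] and H = hd_kids[OF A]
  note R = relabel_facts[OF D(1), folded q_def] and S = swap_in[OF A d, folded X_def q_def]
  have c: "{c} \<subseteq> kids V r p y" using H by (simp add: c_def)
  have \<tau>c: "{\<tau> c} \<subseteq> kids V (\<tau> r) q x" using c R(5) by auto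
  let ?p = "reattach x X q"
  have swap: "swap ((r, p), K, L) = ((\<tau> r, ?p), map \<tau> L @ drop b (map \<tau> K), take b (map \<tau> K))"
    by (simp add: swap_def X_def q_def)
  have hd: "hd (map \<tau> L @ drop b (map \<tau> K)) = \<tau> c"
    using H(1) by (simp add: c_def hd_map)
  from um have um: "\<not> below ?p {\<tau> c} y" "height_le V h (\<tau> r, reattach y {\<tau> c} ?p)"
    unfolding swap returnable_def prod.case hd by auto
  have t': "parent_tree V (\<tau> r) ?p"
    by (rule parent_tree_reattach[OF R(1) S(2) x S(3)])
  have \<tau>c': "{\<tau> c} \<subseteq> kids V (\<tau> r) ?p x"
    using \<tau>c kids_reattach[OF S(2) x_neq_y, of x] by auto
  have nby: "\<not> below q {\<tau> c} y"
    using um(1) S(4) by (simp add: below_reattach_cong)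
  then have nb: "\<not> below p {c} x"
    using R(9)[of "{c}" x] by simp
  moreover have "depth r (reattach x {c} p) w \<le> h" if w: "w \<in> V" for w
  proof (cases "below p {c} w")
    case False
    then show ?thesis
      using depth_reattach[OF D(1) c x nb w] h w by (auto simp: height_le_def)
  next
    case True
    have \<tau>w: "\<tau> w \<in> V" using w permutes_in_image[OF \<tau>] by blast
    have bq: "below q {\<tau> c} (\<tau> w)" using True R(9)[of "{c}" w] by simp
    \<comment> \<open>\<open>y\<close> is not below \<open>\<tau> c\<close> and \<open>x\<close> is
      not below the surplus children, so their subtrees are disjoint, and depths below
      \<open>\<tau> c\<close> survive the surplus move.\<close>
    have "\<not> below q X (\<tau> w)"
      using below_disjoint[OF R(1) \<tau>w bq _ \<tau>c nby S(2,3)] \<tau>c S(2) x_neq_y by (auto simp: kids_def)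
    then have "below ?p {\<tau> c} (\<tau> w)" "depth (\<tau> r) ?p (\<tau> w) = depth r p w"
      using bq S(7)[OF \<tau>w] R(4) by (auto simp: below_reattach_cong)
    moreover have "depth (\<tau> r) ?p x = depth r p y" "depth (\<tau> r) ?p y = depth r p x"
      using S(7)[OF x S(3)] S(7)[OF y S(4)] R(2,3) by auto
    ultimately have "depth (\<tau> r) (reattach y {\<tau> c} ?p) (\<tau> w) = depth r p w + depth r p x - depth r p y"
      using depth_reattach[OF t' \<tau>c' y um(1) \<tau>w] by simp
    moreover have "depth r (reattach x {c} p) w = depth r p w + depth r p x - depth r p y"
      using depth_reattach[OF D(1) c x nb w] True by simp
    ultimately show ?thesis
      using um(2) \<tau>w by (auto simp: height_le_def)
  qed
  ultimately show ?thesis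
    by (auto simp: movable_def height_le_def c_def)
qed

lemma transfer_in:
  assumes "t \<in> low_ordered_trees V x y deg h"
  shows "transfer h t \<in> low_ordered_trees V x y deg' h"
proof -
  obtain r p K L where t: "t = ((r, p), K, L)" by (metis prod.collapse)
  have A: "((r, p), K, L) \<in> ordered_trees V x y deg" and h: "height_le V h (r, p)"
    using assms by (auto simp: t low_ordered_trees_def)
  show ?thesis
  proof (cases "movable h t")
    case True
    then show ?thesis
      using move_in(1)[OF A] by (auto simp: t transfer_def low_ordered_trees_def movable_def move_def)
  next
    case False
    then have d: "depth r p y < depth r p x"
      using movable_or_depth[OF A h] by (simp add: t)
    have "depth (\<tau> r) (relabel \<tau> p) w \<le> h" if "w \<in> V" for w
      using relabel_facts(4)[OF ordered_treesD(1)[OF A], of "\<tau> w"] h that permutes_in_image[OF \<tau>, of w]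
      by (auto simp: height_le_def)
    then have "height_le V h (fst (swap t))"
      using swap_in(6)[OF A d] by (fastforce simp: height_le_def swap_def t)
    then show ?thesis
      using False swap_in(1)[OF A d] by (simp add: t transfer_def low_ordered_trees_def)
  qed
qed

text \<open>The test \<open>returnable h\<close> reveals the branch that was taken: it succeeds on
  every moved tree and, by \<open>returnable_swap\<close>, fails on the image of a tree that is not
  movable. The matching inverse then recovers the tree.\<close>

lemma transfer_inj: "inj_on (transfer h) (low_ordered_trees V x y deg h)"
proof (rule inj_on_inverseI)
  fix t assume "t \<in> low_ordered_trees V x y deg h"
  moreover obtain r p K L where t: "t = ((r, p), K, L)" by (metis prod.collapse)
  ultimately have A: "((r, p), K, L) \<in> ordered_trees V x y deg" and h: "height_le V h (r, p)"
    by (auto simp: low_ordered_trees_def)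
  show "(if returnable h (transfer h t) then unmove (transfer h t) else unswap (transfer h t)) = t"
  proof (cases "movable h t")
    case True
    then have nb: "\<not> below p {hd L} x" by (simp add: t movable_def)
    have "reattach y {hd L} (reattach x {hd L} p) = p"
      using hd_kids[OF A] by (intro reattach_reattach) auto
    then have "returnable h (move t)"
      using move_in(2)[OF A nb] h by (simp add: t returnable_def move_def)
    then show ?thesis
      using True move_in(3)[OF A nb] by (simp add: t transfer_def)
  next
    case False
    then have "\<not> returnable h (swap t)"
      using returnable_swap[OF A h movable_or_depth[OF A h]] by (auto simp: t)
    then show ?thesis
      using False unswap_swap[OF A] by (simp add: t transfer_def)
  qed
qed

section \<open>Trees inside and outside the image\<close>

text \<open>As \<open>y\<close> is below the first child of \<open>x\<close>, it is below no other
  child of \<open>x\<close>, so the surplus bundle can be hung under \<open>y\<close>. After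
  relabelling, \<open>x\<close> is below the first child of \<open>y\<close>, so the preimage is not
  movable, whatever \<open>h\<close> is.\<close>

lemma unswap_in:
  assumes B: "((r, p), K, L) \<in> ordered_trees V x y deg'" and b: "below p {hd K} y"
  shows "unswap ((r, p), K, L) \<in> ordered_trees V x y deg"
    and "swap (unswap ((r, p), K, L)) = ((r, p), K, L)"
    and "\<not> movable h (unswap ((r, p), K, L))"
proof -
  define X where "X = set (drop (Suc b) K)"
  define q where "q = reattach y X p"
  note D = ordered_treesD[OF B] and H = hd_kids'[OF B]
  have X: "X \<subseteq> kids V r p x"
    using set_drop_subset[of "Suc b" K] D(4) by (simp add: X_def)
  have hd_notin: "hd K \<notin> X"
    using D(3) H by (metis X_def distinct.simps(2) drop_Suc in_set_dropD list.sel(3))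
  have c: "{hd K} \<subseteq> kids V r p x" using H by simp
  have nb: "\<not> below p X y"
    using below_disjoint[OF D(1) y b _ c _ X] not_below_own_kids[OF D(1) c x]
      not_below_own_kids[OF D(1) X x] hd_notin by auto
  have t: "parent_tree V r q"
    unfolding q_def by (rule parent_tree_reattach[OF D(1) X y nb])
  have k: "kids V r q u = (if u = y then kids V r p y \<union> X
      else if u = x then kids V r p x - X else kids V r p u)" for u
    unfolding q_def by (rule kids_reattach[OF X x_neq_y[symmetric]])
  note R = relabel_facts[OF t]
  have eq: "unswap ((r, p), K, L) = ((\<tau> r, relabel \<tau> q), map \<tau> (L @ drop (Suc b) K), map \<tau> (take (Suc b) K))"
    by (simp add: unswap_def q_def X_def)
  have disj: "kids V r p y \<inter> X = {}"
    using X x_neq_y by (auto simp: kids_def)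
  have "set (take (Suc b) K) = set K - X"
    using D(3) by (metis X_def append_take_drop_id distinct_append Diff_cancel Int_commute
        Diff_triv Un_Diff set_append Un_empty_right)
  then have sK: "set (take (Suc b) K) = kids V r q x"
    using D(4) x_neq_y by (simp add: k)
  have sL: "set (L @ drop (Suc b) K) = kids V r q y"
    using D(7) by (simp add: k X_def)
  show "unswap ((r, p), K, L) \<in> ordered_trees V x y deg"
    unfolding eq
  proof (rule ordered_treesI)
    show "parent_tree V (\<tau> r) (relabel \<tau> q)" by (rule R(1))
    show "distinct (map \<tau> (L @ drop (Suc b) K))"
    proof -
      have "distinct (L @ drop (Suc b) K)"
        using D(3,6,7) disj by (simp add: X_def)
      then show ?thesis
        unfolding distinct_map by simp
    qed
    show "set (map \<tau> (L @ drop (Suc b) K)) = kids V (\<tau> r) (relabel \<tau> q) x"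
      using sL R(5) by (simp add: image_Un flip: sL)
    show "length (map \<tau> (L @ drop (Suc b) K)) = deg x"
      using D(5,8) x_neq_y deg_x by simp
    show "distinct (map \<tau> (take (Suc b) K))"
      using D(3) by (simp add: distinct_map)
    show "set (map \<tau> (take (Suc b) K)) = kids V (\<tau> r) (relabel \<tau> q) y"
      using sK R(6) by simp
    show "length (map \<tau> (take (Suc b) K)) = deg y"
      using D(5) x_neq_y deg_x deg_y by simp
    show "card (kids V (\<tau> r) (relabel \<tau> q) u) = deg u" if "u \<in> V" "u \<noteq> x" "u \<noteq> y" for u
      using R(7)[OF that(2,3)] D(2)[OF that(1)] that by (simp add: k)
  qed
  have [simp]: "map \<tau> (map \<tau> zs) = zs" for zs :: "'a list" by (simp add: comp_def)
  have "drop b (map \<tau> (map \<tau> (L @ drop (Suc b) K))) = drop (Suc b) K"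
       "take b (map \<tau> (map \<tau> (L @ drop (Suc b) K))) = L"
    using D(8) by (simp_all del: map_map)
  moreover have "reattach x X q = p"
    unfolding q_def by (rule reattach_reattach[OF X])
  ultimately show "swap (unswap ((r, p), K, L)) = ((r, p), K, L)"
    unfolding eq by (simp add: swap_def R(8) X_def del: map_map)
  have "below q {hd K} y"
    using b nb by (simp add: q_def below_reattach_cong)
  then have "below (relabel \<tau> q) {\<tau> (hd K)} x"
    using R(9)[of "{hd K}" y] by simp
  moreover have "hd (map \<tau> (take (Suc b) K)) = \<tau> (hd K)"
    using H(1) by (cases K) auto
  ultimately show "\<not> movable h (unswap ((r, p), K, L))"
    by (simp add: eq movable_def)
qed

text \<open>When \<open>h\<close> bounds all heights, only acyclicity decides between the branches.
  Every target then has a preimage: return the first child of \<open>x\<close> if \<open>y\<close>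
  is not below it, and undo the exchange otherwise.\<close>

lemma transfer_bij:
  assumes hA: "low_ordered_trees V x y deg h = ordered_trees V x y deg"
    and hB: "low_ordered_trees V x y deg' h = ordered_trees V x y deg'"
  shows "bij_betw (transfer h) (ordered_trees V x y deg) (ordered_trees V x y deg')"
proof -
  have "u \<in> transfer h ` ordered_trees V x y deg" if "u \<in> ordered_trees V x y deg'" for u
  proof -
    obtain r p K L where u: "u = ((r, p), K, L)" by (metis prod.collapse)
    have B: "((r, p), K, L) \<in> ordered_trees V x y deg'" using that u by simp
    show ?thesis
    proof (cases "below p {hd K} y")
      case True
      show ?thesis
        using unswap_in(1,2)[OF B True] unswap_in(3)[OF B True, of h] by (force simp: u transfer_def)
    next
      case False
      note U = unmove_in[OF B False]
      have "reattach x {hd K} (reattach y {hd K} p) = p"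
        using hd_kids'[OF B] by (intro reattach_reattach) auto
      moreover have "u \<in> low_ordered_trees V x y deg' h"
        using that hB by simp
      then have "height_le V h (r, p)"
        by (simp add: u low_ordered_trees_def)
      ultimately have "movable h (unmove u)"
        using U(2) by (simp add: u unmove_def movable_def)
      then show ?thesis
        using U(1,3) by (force simp: u transfer_def)
    qed
  qed
  then show ?thesis
    using transfer_inj[of h] transfer_in[of _ h] unfolding hA hB bij_betw_def by blast
qed

text \<open>One obstruction for each branch: the child of a moved tree can be returned within height
  \<open>h\<close>, and in a swapped tree \<open>y\<close> is not below the children of
  \<open>x\<close> from position \<open>Suc b\<close> on.\<close>

lemma not_in_transfer_image:
  assumes B: "((r, p), K, L) \<in> ordered_trees V x y deg'"
    and b: "below p (set (drop (Suc b) K)) y" and nh: "\<not> height_le V h (r, reattach y {hd K} p)"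
  shows "((r, p), K, L) \<notin> transfer h ` low_ordered_trees V x y deg h"
proof
  assume "((r, p), K, L) \<in> transfer h ` low_ordered_trees V x y deg h"
  then obtain r0 p0 K0 L0 where A: "((r0, p0), K0, L0) \<in> ordered_trees V x y deg"
    and h: "height_le V h (r0, p0)" and eq: "((r, p), K, L) = transfer h ((r0, p0), K0, L0)"
    by (auto simp: low_ordered_trees_def)
  show False
  proof (cases "movable h ((r0, p0), K0, L0)")
    case True
    have "reattach y {hd L0} (reattach x {hd L0} p0) = p0"
      using hd_kids[OF A] by (intro reattach_reattach) auto
    then show False
      using True eq nh h by (simp add: transfer_def move_def)
  next
    case False
    have "K = map \<tau> L0 @ drop b (map \<tau> K0)"
      "p = reattach x (set (drop b (map \<tau> K0))) (relabel \<tau> p0)"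
      using False eq by (auto simp: transfer_def swap_def)
    \<comment> \<open>\<open>L0\<close> has \<open>Suc b\<close> elements, so
      \<open>drop (Suc b) K\<close> is exactly the surplus bundle.\<close>
    then show False
      using swap_in(5)[OF A movable_or_depth[OF A h False]] b ordered_treesD(8)[OF A] deg_y by simp
  qed
qed

end

section \<open>Distribution functions of the height\<close>

definition low_trees :: "'a set \<Rightarrow> ('a \<Rightarrow> nat) \<Rightarrow> nat \<Rightarrow> ('a \<times> ('a \<Rightarrow> 'a)) set" where
  "low_trees V deg h = {t \<in> parent_trees V deg. height_le V h t}"

definition height_cdf :: "'a set \<Rightarrow> ('a \<Rightarrow> nat) \<Rightarrow> nat \<Rightarrow> real" where
  "height_cdf V deg h = card (low_trees V deg h) / card (parent_trees V deg)"

text \<open>A parent map is the identity off \<open>V\<close>, hence determined by its restriction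
  to \<open>V\<close>.\<close>

lemma finite_parent_trees:
  assumes "finite V"
  shows "finite (parent_trees V deg)"
proof (rule finite_subset)
  let ?ext = "\<lambda>f v. if v \<in> V then f v else v"
  show "parent_trees V deg \<subseteq> V \<times> (?ext ` (V \<rightarrow>\<^sub>E V))"
  proof clarsimp
    fix r p assume "(r, p) \<in> parent_trees V deg"
    then have t: "parent_tree V r p" by (simp add: parent_trees_def)
    have "p = ?ext (restrict p V)" "restrict p V \<in> V \<rightarrow>\<^sub>E V"
      using parent_treeD[OF t] by (auto simp: fun_eq_iff)
    then show "r \<in> V \<and> p \<in> ?ext ` (V \<rightarrow>\<^sub>E V)"
      using parent_treeD(1)[OF t] by blast
  qed
  show "finite (V \<times> (?ext ` (V \<rightarrow>\<^sub>E V)))"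
    using assms by (intro finite_cartesian_product finite_imageI finite_PiE)
qed

lemma card_low_ordered_trees:
  assumes "finite V" "x \<in> V" "y \<in> V"
  shows "card (low_ordered_trees V x y deg h) = card (low_trees V deg h) * (fact (deg x) * fact (deg y))"
    and "card (ordered_trees V x y deg) = card (parent_trees V deg) * (fact (deg x) * fact (deg y))"
proof -
  have *: "card (SIGMA t : T. permutations_of_set (kids V (fst t) (snd t) x) \<times>
      permutations_of_set (kids V (fst t) (snd t) y)) = card T * (fact (deg x) * fact (deg y))"
    if T: "T \<subseteq> parent_trees V deg" for T
  proof (subst card_SigmaI)
    show "finite T"
      using T finite_parent_trees[OF assms(1)] by (rule finite_subset)
    have "card (permutations_of_set (kids V (fst t) (snd t) u)) = fact (deg u)"
      if "t \<in> T" "u \<in> V" for t u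
      using T that assms finite_kids[OF assms(1)]
      by (auto simp: parent_trees_def card_permutations_of_set)
    then show "(\<Sum>t\<in>T. card (permutations_of_set (kids V (fst t) (snd t) x) \<times>
        permutations_of_set (kids V (fst t) (snd t) y))) = card T * (fact (deg x) * fact (deg y))"
      using assms by (simp add: card_cartesian_product)
  qed auto
  have "low_ordered_trees V x y deg h = (SIGMA t : low_trees V deg h.
      permutations_of_set (kids V (fst t) (snd t) x) \<times> permutations_of_set (kids V (fst t) (snd t) y))"
    unfolding low_ordered_trees_def ordered_trees_def low_trees_def by auto
  then show "card (low_ordered_trees V x y deg h) =
      card (low_trees V deg h) * (fact (deg x) * fact (deg y))"
    using *[of "low_trees V deg h"] by (simp add: low_trees_def)
  show "card (ordered_trees V x y deg) = card (parent_trees V deg) * (fact (deg x) * fact (deg y))"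
    using *[of "parent_trees V deg"] by (simp add: ordered_trees_def)
qed

text \<open>The number of orders per tree is positive and cancels in the quotient.\<close>

lemma height_cdf_ordered:
  assumes "finite V" "x \<in> V" "y \<in> V"
  shows "height_cdf V deg h = card (low_ordered_trees V x y deg h) / card (ordered_trees V x y deg)"
  unfolding card_low_ordered_trees[OF assms] height_cdf_def by simp

lemma ex_height_bound:
  assumes "finite V"
  shows "\<exists>h. low_trees V deg h = parent_trees V deg \<and> low_trees V deg2 h = parent_trees V deg2"
proof -
  let ?D = "(\<lambda>((r, p), v). depth r p v) ` ((parent_trees V deg \<union> parent_trees V deg2) \<times> V)"
  have "finite ?D"
    using assms finite_parent_trees by blast
  then have "d \<in> ?D \<Longrightarrow> d \<le> Max ?D" for d by simp
  then have "height_le V (Max ?D) t" if "t \<in> parent_trees V deg \<union> parent_trees V deg2" for t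
    using that by (force simp: height_le_def split: prod.split)
  then show ?thesis
    unfolding low_trees_def by blast
qed

context transfer_child
begin

text \<open>At a level \<open>h\<close> bounding all heights the transfer is a bijection. Hence the
  two distribution functions have equal denominators, and only numerators remain to be
  compared.\<close>

lemma card_ordered_trees_eq: "card (ordered_trees V x y deg) = card (ordered_trees V x y deg')"
proof -
  obtain h where h: "low_trees V deg h = parent_trees V deg" "low_trees V deg' h = parent_trees V deg'"
    using ex_height_bound[OF finite_V] by blast
  have *: "low_ordered_trees V x y g h = ordered_trees V x y g"
    if g: "low_trees V g h = parent_trees V g" for g
  proof -
    have "height_le V h t" if "t \<in> parent_trees V g" for t
    proof -
      from that have "t \<in> low_trees V g h" by (simp only: g)
      then show ?thesis by (simp add: low_trees_def)
    qed
    then show ?thesis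
      unfolding low_ordered_trees_def ordered_trees_def by (auto simp only: mem_Sigma_iff mem_Collect_eq fst_conv split_paired_all)
  qed
  show ?thesis
    by (rule bij_betw_same_card[OF transfer_bij[OF *[OF h(1)] *[OF h(2)]]])
qed

lemma finite_ordered_trees: "finite (ordered_trees V x y g)"
  unfolding ordered_trees_def using finite_parent_trees[OF finite_V]
  by (intro finite_SigmaI finite_cartesian_product) auto

lemma height_cdf_le: "height_cdf V deg h \<le> height_cdf V deg' h"
proof -
  have "card (low_ordered_trees V x y deg h) \<le> card (low_ordered_trees V x y deg' h)"
    using transfer_inj transfer_in finite_ordered_trees
    by (intro card_inj_on_le[of "transfer h"]) (auto simp: low_ordered_trees_def)
  then show ?thesis
    unfolding height_cdf_ordered[OF finite_V x y] card_ordered_trees_eq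
    by (intro divide_right_mono) auto
qed

lemma height_cdf_less:
  assumes B: "((r, p), K, L) \<in> ordered_trees V x y deg'" and h: "height_le V h (r, p)"
    and b: "below p (set (drop (Suc b) K)) y" and nh: "\<not> height_le V h (r, reattach y {hd K} p)"
  shows "height_cdf V deg h < height_cdf V deg' h"
proof -
  have fin: "finite (low_ordered_trees V x y deg' h)"
    using finite_ordered_trees by (auto simp: low_ordered_trees_def)
  have "((r, p), K, L) \<in> low_ordered_trees V x y deg' h"
    using B h by (simp add: low_ordered_trees_def)
  then have "transfer h ` low_ordered_trees V x y deg h \<subset> low_ordered_trees V x y deg' h"
    using not_in_transfer_image[OF B b nh] transfer_in by blast
  then have "card (low_ordered_trees V x y deg h) < card (low_ordered_trees V x y deg' h)"
    using psubset_card_mono[OF fin] card_image[OF transfer_inj] by metis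
  moreover have "0 < card (ordered_trees V x y deg')"
    using B finite_ordered_trees card_gt_0_iff by blast
  ultimately show ?thesis
    unfolding height_cdf_ordered[OF finite_V x y] card_ordered_trees_eq
    by (intro divide_strict_right_mono) auto
qed

end

section \<open>A tree that witnesses strictness\<close>

text \<open>Blocks of size \<open>g u\<close> are cut off from \<open>R\<close> for one
  \<open>u\<close> after another. This distributes the leaves of the witness tree over the free
  child slots.\<close>

lemma ex_function_with_fibre_sizes:
  assumes "finite U" "finite R" "sum g U = card R"
  shows "\<exists>f. (\<forall>v\<in>R. f v \<in> U) \<and> (\<forall>u\<in>U. card {v \<in> R. f v = u} = g u)"
  using assms
proof (induction U arbitrary: R rule: finite_induct)
  case empty
  then show ?case by simp
next
  case (insert u U)
  then obtain Q where Q: "Q \<subseteq> R" "card Q = g u"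
    by (metis le_add1 obtain_subset_with_card_n sum.insert)
  then have "sum g U = card (R - Q)"
    using insert by (simp add: card_Diff_subset finite_subset)
  then obtain f where f: "\<forall>v\<in>R - Q. f v \<in> U" "\<forall>u\<in>U. card {v \<in> R - Q. f v = u} = g u"
    using insert.IH[of "R - Q"] insert.prems by auto
  let ?f = "\<lambda>v. if v \<in> Q then u else f v"
  have "{v \<in> R. ?f v = u} = Q"
    using Q f insert.hyps by auto
  moreover have "{v \<in> R. ?f v = w} = {v \<in> R - Q. f v = w}" if "w \<in> U" for w
    using that insert.hyps by auto
  ultimately show ?case
    using Q f by (intro exI[of _ ?f]) auto
qed

context transfer_child
begin

text \<open>The witness has height \<open>Suc m\<close>. The first child of its root
  \<open>x\<close> is the start \<open>e 1\<close> of the path and the last one is \<open>y\<close>,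
  which therefore sits at a surplus position. Hanging the path under \<open>y\<close> would exceed
  the height, so both obstructions of \<open>not_in_transfer_image\<close> are present.\<close>

lemma ex_height_cdf_less:
  assumes sum_deg: "sum deg V + 1 = card V" and z: "z \<in> V" "z \<noteq> x" "z \<noteq> y" "0 < deg z"
  shows "\<exists>h. height_cdf V deg h < height_cdf V deg' h"
proof -
  \<comment> \<open>The path is \<open>e 0, \<dots>, e m\<close> with \<open>e 0 = x\<close>; \<open>R\<close> collects the leaves, which are distributed
    arbitrarily over the remaining child slots.\<close>
  define S where "S = {v \<in> V - {x, y}. 0 < deg v}"
  define C where "C = insert y S"
  define R where "R = V - insert x C"
  define m where "m = card S"
  have fin: "finite S" "finite C" "finite R"
    using finite_V by (auto simp: S_def C_def R_def)
  have zS: "z \<in> S" using z by (simp add: S_def)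
  then have m: "0 < m"
    unfolding m_def using fin card_gt_0_iff by blast
  obtain e0 where e0: "bij_betw e0 {0..<m} S"
    using ex_bij_betw_nat_finite[OF fin(1)] unfolding m_def by blast
  define e where "e i = (case i of 0 \<Rightarrow> x | Suc j \<Rightarrow> e0 j)" for i
  have e_0: "e 0 = x" and e_S: "0 < i \<Longrightarrow> i \<le> m \<Longrightarrow> e i \<in> S" for i
    using bij_betwE[OF e0] by (auto simp: e_def split: nat.split)
  have xS: "x \<notin> S" "y \<notin> S" by (auto simp: S_def)
  have inj_e: "inj_on e {..m}"
  proof (rule inj_onI)
    fix i j assume ij: "i \<in> {..m}" "j \<in> {..m}" "e i = e j"
    have "x \<notin> e0 ` {0..<m}"
      using e0 xS by (simp add: bij_betw_def)
    with ij show "i = j"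
      using inj_onD[OF bij_betw_imp_inj_on[OF e0]]
      by (cases i; cases j) (auto simp: e_def Suc_le_eq image_iff)
  qed
  define idx where "idx = inv_into {..m} e"
  have idx_e: "idx (e i) = i" if "i \<le> m" for i
    unfolding idx_def using inj_e that by (intro inv_into_f_f) auto
  have S_e: "\<exists>i. 0 < i \<and> i \<le> m \<and> v = e i" if "v \<in> S" for v
  proof -
    from that have "v \<in> e0 ` {0..<m}"
      using e0 by (simp add: bij_betw_def)
    then obtain j where "j < m" "v = e0 j" by auto
    then have "0 < Suc j \<and> Suc j \<le> m \<and> v = e (Suc j)" by (simp add: e_def)
    then show ?thesis ..
  qed
  define p0 where "p0 v = (if v = y then x else e (idx v - 1))" for v
  have p0_e: "p0 (e i) = e (i - 1)" if "0 < i" "i \<le> m" for i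
    using that idx_e xS e_S by (auto simp: p0_def)
  have p0_C: "p0 v \<in> insert x S" if "v \<in> C" for v
  proof (cases "v = y")
    case False
    then obtain i where "0 < i" "i \<le> m" "v = e i"
      using \<open>v \<in> C\<close> S_e by (auto simp: C_def)
    then show ?thesis
      using p0_e e_0 e_S[of "i - 1"] by (cases "i = 1") auto
  qed (simp add: p0_def)
  define core where "core u = card {v \<in> C. p0 v = u}" for u
  \<comment> \<open>The children \<open>e 1\<close> and \<open>y\<close> fit under \<open>x\<close>
    because \<open>deg x\<close> is positive and the transfer adds one.\<close>
  have core_x: "core x \<le> deg' x"
  proof -
    have *: "{v \<in> C. p0 v = x} \<subseteq> {e 1, y}"
    proof
      fix v assume "v \<in> {v \<in> C. p0 v = x}"
      then have v: "v \<in> C" "p0 v = x" by auto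
      show "v \<in> {e 1, y}"
      proof (cases "v = y")
        case False
        then obtain i where i: "0 < i" "i \<le> m" "v = e i"
          using S_e v by (auto simp: C_def)
        then have "e (i - 1) = e 0"
          using v p0_e e_0 by simp
        then have "i - 1 = 0"
          using i by (intro inj_onD[OF inj_e]) auto
        then have "i = 1" using i by simp
        then show ?thesis using i by simp
      qed simp
    qed
    have "core x \<le> card {e 1, y}"
      unfolding core_def by (rule card_mono[OF _ *]) simp
    also have "\<dots> \<le> 2" by (simp add: card_insert_if)
    also have "2 \<le> deg' x" using deg_x x_neq_y by simp
    finally show ?thesis .
  qed
  have core_e: "{v \<in> C. p0 v = e i} \<subseteq> (if i < m then {e (Suc i)} else {})" if i: "0 < i" "i \<le> m" for i
  proof
    fix v assume v: "v \<in> {v \<in> C. p0 v = e i}"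
    then have "v \<noteq> y"
      using e_S[OF i] xS by (auto simp: p0_def)
    then obtain j where j: "0 < j" "j \<le> m" "v = e j"
      using v S_e by (auto simp: C_def)
    then have "e (j - 1) = e i" using v p0_e by simp
    then have "j - 1 = i"
      using i j by (intro inj_onD[OF inj_e]) auto
    then show "v \<in> (if i < m then {e (Suc i)} else {})" using j by auto
  qed
  have core_le: "core u \<le> deg' u" if u: "u \<in> V" for u
  proof -
    consider "u = x" | "u \<in> S" | "u \<notin> insert x S" by blast
    then show ?thesis
    proof cases
      case 2
      then obtain i where i: "0 < i" "i \<le> m" "u = e i" using S_e by blast
      have "core u \<le> card (if i < m then {e (Suc i)} else {})"
        unfolding core_def i(3) by (rule card_mono[OF _ core_e[OF i(1,2)]]) simp
      also have "\<dots> \<le> 1" by simp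
      also have "1 \<le> deg' u" using 2 by (auto simp: S_def)
      finally show ?thesis .
    next
      case 3
      then have "{v \<in> C. p0 v = u} = {}" using p0_C by auto
      then have "core u = 0" unfolding core_def by (simp only: card.empty)
      then show ?thesis by simp
    qed (use core_x in simp)
  qed
  \<comment> \<open>No vertex of \<open>C\<close> hangs at the end of the path, so its child slots,
    at least one, all go to leaves; this provides the deepest leaf \<open>l\<close>.\<close>
  have core_last: "core (e m) = 0"
  proof -
    have "{v \<in> C. p0 v = e m} \<subseteq> {}"
      using core_e[OF m order_refl] by (simp only: less_irrefl if_False)
    then have "{v \<in> C. p0 v = e m} = {}" by (rule subset_empty[THEN iffD1])
    then show ?thesis unfolding core_def by (simp only: card.empty)
  qed
  have CV: "insert x C \<subseteq> V" "x \<notin> C" using x y x_neq_y by (auto simp: C_def S_def)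
  \<comment> \<open>The slots left for leaves; by \<open>core_le\<close> the truncated subtraction
    is exact.\<close>
  define g where "g u = deg' u - core u" for u
  have sum_g: "sum g V = card R"
  proof -
    have "sum core V = card C"
    proof -
      have "sum core V = card (\<Union>u\<in>V. {v \<in> C. p0 v = u})"
        unfolding core_def using finite_V fin by (subst card_UN_disjoint) auto
      also have "(\<Union>u\<in>V. {v \<in> C. p0 v = u}) = C"
        using p0_C CV by (auto simp: C_def)
      finally show ?thesis .
    qed
    moreover have "sum deg' V = sum deg V"
    proof -
      have yV: "y \<in> V - {x}" and fV: "finite (V - {x})"
        using finite_V y x_neq_y by auto
      have "sum f V = f x + (f y + sum f (V - {x, y}))" for f :: "'a \<Rightarrow> nat"
        unfolding Diff_insert2[of V x "{y}"]
        using sum.remove[OF finite_V x, of f] sum.remove[OF fV yV, of f] by simp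
      moreover have "sum deg' (V - {x, y}) = sum deg (V - {x, y})"
        by (rule sum.cong) auto
      ultimately show ?thesis
        using deg_y x_neq_y by simp
    qed
    moreover have "sum g V = sum deg' V - sum core V"
      unfolding g_def using core_le by (intro sum_subtractf_nat) auto
    moreover have "card R = card V - Suc (card C)"
      unfolding R_def using CV fin by (simp add: card_Diff_subset)
    ultimately show ?thesis using sum_deg by simp
  qed
  obtain f where f: "\<forall>v\<in>R. f v \<in> V" "\<forall>u\<in>V. card {v \<in> R. f v = u} = g u"
    using ex_function_with_fibre_sizes[OF finite_V fin(3) sum_g] by blast
  \<comment> \<open>Vertices outside \<open>insert x C\<close> have no child slots, so no leaf is
    hung under another leaf.\<close>
  have f_R: "f v \<in> insert x C" if "v \<in> R" for v
  proof (rule ccontr)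
    assume "f v \<notin> insert x C"
    then have "f v \<in> V" "deg' (f v) = 0"
      using f(1) that by (auto simp: C_def S_def)
    then have "{w \<in> R. f w = f v} = {}"
      using f(2) fin(3) by (auto simp: g_def)
    then show False using that by blast
  qed
  define p where "p v = (if v \<in> C then p0 v else if v \<in> R then f v else v)" for v
  define D0 where "D0 v = (if v = y then 1 else idx v)" for v
  define D where "D v = (if v \<in> R then Suc (D0 (f v)) else D0 v)" for v
  have D0_e: "D0 (e i) = i" if "i \<le> m" for i
    using that idx_e e_S[of i] e_0 xS x_neq_y by (cases "i = 0") (auto simp: D0_def)
  have D0_le: "D0 v \<le> m" if "v \<in> insert x C" for v
    using that m D0_e[of 0] e_0 D0_e S_e by (fastforce simp: C_def D0_def)
  have D0_p0: "D0 v = Suc (D0 (p0 v))" if "v \<in> C" for v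
  proof (cases "v = y")
    case True
    then show ?thesis
      using D0_e[of 0] e_0 by (simp add: p0_def D0_def)
  next
    case False
    then obtain i where "0 < i" "i \<le> m" "v = e i"
      using \<open>v \<in> C\<close> S_e by (auto simp: C_def)
    then show ?thesis
      using p0_e D0_e D0_e[of "i - 1"] by simp
  qed
  have VCR: "v \<in> C \<or> v \<in> R" if "v \<in> V" "v \<noteq> x" for v
    using that by (auto simp: R_def)
  have RC: "v \<notin> R" if "v \<in> insert x C" for v
    using that by (auto simp: R_def)
  have pV: "p v \<in> insert x C" if "v \<in> V" for v
    using that VCR[OF that] p0_C f_R RC CV(2) by (cases "v = x") (auto simp: p_def C_def)
  have D_p: "D v = Suc (D (p v))" if "v \<in> V" "v \<noteq> x" for v
    using VCR[OF that] D0_p0 RC p0_C f_R pV[OF that(1)] by (auto simp: D_def p_def)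
  have t: "parent_tree V x p"
  proof (rule parent_treeI[where D = D])
    show "p v = v" if "v \<notin> V - {x}" for v
      using that CV by (auto simp: p_def R_def)
  qed (use x pV CV D_p in auto)
  have "D x = 0"
    using RC D0_e[of 0] e_0 by (simp add: D_def)
  then have depth: "depth x p v = D v" if "v \<in> V" for v
    using depth_unique[OF t that] D_p by blast
  have kids: "kids V x p u = {v \<in> C. p0 v = u} \<union> {v \<in> R. f v = u}" for u
    using CV RC VCR by (auto simp: kids_def p_def R_def)
  have card_kids: "card (kids V x p u) = deg' u" if "u \<in> V" for u
  proof -
    have "card (kids V x p u) = core u + g u"
      unfolding kids core_def using f(2) that fin RC
      by (subst card_Un_disjoint) auto
    then show ?thesis using core_le[OF that] by (simp add: g_def)
  qed
  obtain l where l: "l \<in> R" "f l = e m"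
  proof -
    have "e m \<in> S" using e_S m by blast
    then have "0 < card {v \<in> R. f v = e m}"
      using f(2) core_last by (auto simp: g_def S_def)
    then show ?thesis using that by (auto simp: card_gt_0_iff)
  qed
  have lV: "l \<in> V" using l by (simp add: R_def)
  have ek: "{e 1} \<subseteq> kids V x p x" and yk: "y \<in> kids V x p x"
    using p0_e[of 1] e_0 m e_S[of 1] by (auto simp: kids C_def p0_def)
  have ey: "e 1 \<noteq> y" using e_S[of 1] m xS by auto
  obtain K0 where K0: "distinct K0" "set K0 = kids V x p x - {e 1, y}"
    using finite_distinct_list[of "kids V x p x - {e 1, y}"] finite_kids[OF finite_V] by blast
  obtain L where L: "distinct L" "set L = kids V x p y"
    using finite_distinct_list finite_kids[OF finite_V] by metis
  define K where "K = e 1 # K0 @ [y]"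
  have K: "distinct K" "set K = kids V x p x"
    using K0 ek yk ey by (auto simp: K_def)
  have B: "((x, p), K, L) \<in> ordered_trees V x y deg'"
    by (rule ordered_treesI[OF t card_kids K(1,2) _ L])
      (use K L distinct_card[of K] distinct_card[of L] card_kids x y in auto)
  have "length K = Suc (deg x)"
    using ordered_treesD(5)[OF B] x_neq_y by simp
  \<comment> \<open>The last entry \<open>y\<close> of \<open>K\<close> has position
    \<open>deg x\<close>, which is at least \<open>Suc b\<close>.\<close>
  then have "y \<in> set (drop (Suc b) K)"
    using deg_x by (simp add: K_def)
  then have b: "below p (set (drop (Suc b) K)) y"
    by (subst below_iff) simp
  have h: "height_le V (Suc m) (x, p)"
  proof -
    have "D v \<le> Suc m" if "v \<in> V" for v
      using VCR[OF that] D0_le[of v] D0_le[of "f v"] f_R[of v] \<open>D x = 0\<close>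
      by (cases "v = x") (auto simp: D_def le_SucI)
    then show ?thesis by (simp add: height_le_def depth)
  qed
  have "below p {e 1} (e i)" if "0 < i" "i \<le> m" for i
    using that
  proof (induction i)
    case (Suc i)
    then have "p (e (Suc i)) = e i"
      using p0_e[of "Suc i"] e_S[of "Suc i"] by (simp add: p_def C_def)
    with Suc show ?case by (cases "i = 0") (auto intro: below_iff[THEN iffD2])
  qed simp
  then have "below p {e 1} (p l)"
    using l m RC by (auto simp: p_def)
  then have bl: "below p {e 1} l" by (auto intro: below_iff[THEN iffD2])
  have nb: "\<not> below p {e 1} y"
  proof
    assume "below p {e 1} y"
    moreover have "p y = x" by (simp add: p_def C_def p0_def)
    ultimately have "below p {e 1} x"
      using below_iff[of p "{e 1}" y] ey by simp
    then show False using not_below_own_kids[OF t ek x] by simp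
  qed
  \<comment> \<open>\<open>y\<close> is one level below the root \<open>x\<close>, so
    \<open>l\<close> sinks by one from depth \<open>Suc m\<close>.\<close>
  have "depth x (reattach y {e 1} p) l = Suc (Suc m)"
    using depth_reattach[OF t ek y nb lV] bl depth[OF lV] depth[OF y] RC l D0_e[of m]
    by (simp add: D_def C_def D0_def)
  then have nh: "\<not> height_le V (Suc m) (x, reattach y {hd K} p)"
    using lV by (auto simp: height_le_def K_def intro!: bexI[of _ l])
  show ?thesis
    using height_cdf_less[OF B h b nh] by blast
qed

end

section \<open>Invariance under permuting the degrees\<close>

text \<open>Conjugation by \<open>\<pi>\<close> maps the trees for \<open>deg \<circ> \<pi>\<close>
  to those for \<open>deg\<close> and preserves heights; conjugation by \<open>inv \<pi>\<close>
  undoes it.\<close>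

lemma height_cdf_permute:
  assumes "finite V" and \<pi>: "\<pi> permutes V"
  shows "height_cdf V (deg \<circ> \<pi>) h = height_cdf V deg h"
proof -
  have *: "(\<sigma> r, relabel \<sigma> p) \<in> parent_trees V deg \<and> height_le V h (\<sigma> r, relabel \<sigma> p) = height_le V h (r, p)"
    if \<sigma>: "\<sigma> permutes V" and t: "(r, p) \<in> parent_trees V (deg \<circ> \<sigma>)" for \<sigma> r p deg h
  proof -
    have ball: "(\<forall>u\<in>V. P u) \<longleftrightarrow> (\<forall>w\<in>V. P (\<sigma> w))" for P
      using permutes_image[OF \<sigma>] by (metis image_iff)
    have t': "parent_tree V r p" using t by (simp add: parent_trees_def)
    have "card (kids V (\<sigma> r) (relabel \<sigma> p) (\<sigma> u)) = deg (\<sigma> u)" if "u \<in> V" for u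
      using t that permutes_inj_on[OF \<sigma>] by (simp add: kids_relabel[OF \<sigma>] card_image parent_trees_def)
    then have "\<forall>u\<in>V. card (kids V (\<sigma> r) (relabel \<sigma> p) u) = deg u"
      by (subst ball) blast
    moreover have "height_le V h (\<sigma> r, relabel \<sigma> p) = height_le V h (r, p)"
      unfolding height_le_def prod.case ball[of "\<lambda>v. depth (\<sigma> r) (relabel \<sigma> p) v \<le> h"]
        depth_relabel[OF \<sigma>] ..
    ultimately show ?thesis
      using parent_tree_relabel[OF \<sigma> t'] by (simp add: parent_trees_def)
  qed
  define F where "F \<sigma> = (\<lambda>(r :: 'a, p). (\<sigma> r, relabel \<sigma> p))" for \<sigma> :: "'a \<Rightarrow> 'a"
  have inv_inv: "F (inv \<sigma>) (F \<sigma> t) = t" if "\<sigma> permutes V" for \<sigma> t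
    using permutes_inverses[OF that] relabel_inv[OF that] by (simp add: F_def split: prod.split)
  have \<pi>': "inv \<pi> permutes V" by (rule permutes_inv[OF \<pi>])
  have FF: "F \<pi> (F (inv \<pi>) t) = t" for t
    using inv_inv[OF \<pi>'] permutes_inv_inv[OF \<pi>] by simp
  have comp: "deg \<circ> \<pi> \<circ> inv \<pi> = deg"
    using permutes_inv_o(1)[OF \<pi>] by (simp add: comp_assoc)
  \<comment> \<open>The two choices of \<open>P\<close> give the denominator and the numerator of
    \<open>height_cdf\<close>.\<close>
  have "bij_betw (F \<pi>) {t \<in> parent_trees V (deg \<circ> \<pi>). P t} {t \<in> parent_trees V deg. P t}"
    if P: "P = (\<lambda>_. True) \<or> P = height_le V h" for P
  proof (rule bij_betw_byWitness[where f' = "F (inv \<pi>)"])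
    show "F \<pi> ` {t \<in> parent_trees V (deg \<circ> \<pi>). P t} \<subseteq> {t \<in> parent_trees V deg. P t}"
      using P *[OF \<pi>, of _ _ deg h] by (auto simp: F_def)
    show "F (inv \<pi>) ` {t \<in> parent_trees V deg. P t} \<subseteq> {t \<in> parent_trees V (deg \<circ> \<pi>). P t}"
      using P *[OF \<pi>', of _ _ "deg \<circ> \<pi>" h] unfolding comp by (auto simp: F_def)
  qed (use inv_inv[OF \<pi>] FF in auto)
  from bij_betw_same_card[OF this[of "\<lambda>_. True"]] bij_betw_same_card[OF this[of "height_le V h"]]
  show ?thesis
    by (simp add: height_cdf_def low_trees_def)
qed

section \<open>Graphs of parent maps\<close>

text \<open>Each parent edge contributes both orientations, because undirected graphs are
  represented by symmetric digraphs.\<close>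

definition tree_graph :: "'a set \<Rightarrow> 'a \<times> ('a \<Rightarrow> 'a) \<Rightarrow> 'a rooted_graph" where
  "tree_graph V = (\<lambda>(r, p). (r, \<lparr> pverts = V,
     parcs = (\<lambda>v. (v, p v)) ` (V - {r}) \<union> (\<lambda>v. (p v, v)) ` (V - {r}) \<rparr>))"

section \<open>Walks, cycles and distances as lists of arcs\<close>

lemma awalk_with_proj_iff:
  "pre_digraph.awalk (with_proj G) u es v \<longleftrightarrow> u \<in> pverts G \<and> set es \<subseteq> parcs G \<and> pcas u es v"
  by (simp add: pre_digraph.awalk_def cas_with_proj_eq)

lemma pcas_append: "pcas u (es @ fs) v \<longleftrightarrow> (\<exists>w. pcas u es w \<and> pcas w fs v)"
  by (induction es arbitrary: u) auto

lemma pcas_verts: "pcas u es v \<Longrightarrow> pawalk_verts u es = u # map snd es"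
  by (induction es arbitrary: u) auto

lemma cycle_with_proj_iff:
  "pre_digraph.cycle (with_proj G) es \<longleftrightarrow>
     (\<exists>u\<in>pverts G. set es \<subseteq> parcs G \<and> pcas u es u \<and> distinct (map snd es) \<and> es \<noteq> [])"
  unfolding pre_digraph.cycle_def awalk_with_proj_iff awalk_verts_with_proj_eq
  using pcas_verts by fastforce

lemma pcas_nth:
  assumes "pcas u es v" "i < length es"
  shows "fst (es ! i) = (if i = 0 then u else snd (es ! (i - 1)))"
  using assms
proof (induction es arbitrary: u i)
  case (Cons e es)
  then show ?case by (cases i) auto
qed simp

lemma pcas_last: "pcas u es v \<Longrightarrow> es \<noteq> [] \<Longrightarrow> v = snd (es ! (length es - 1))"
proof (induction es arbitrary: u)
  case (Cons e es)
  then show ?case by (cases es) auto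
qed simp

text \<open>Take \<open>b\<close> on the cycle with \<open>D b\<close> maximal; its two neighbours
  are distinct since the length is at least 3. With the depth as \<open>D\<close> both would have to
  be the parent of \<open>b\<close>, so graphs of parent maps have no such cycle.\<close>

lemma ex_peak_of_cycle:
  fixes D :: "'a \<Rightarrow> nat"
  assumes cyc: "pre_digraph.cycle (with_proj G) es" and len: "3 \<le> length es"
  shows "\<exists>a b c. a \<noteq> c \<and> (a, b) \<in> parcs G \<and> (b, c) \<in> parcs G \<and> D a \<le> D b \<and> D c \<le> D b"
proof -
  obtain u where es: "set es \<subseteq> parcs G" "pcas u es u" "distinct (map snd es)"
    using cyc by (auto simp: cycle_with_proj_iff)
  define m where "m = length es"
  define x where "x i = snd (es ! i)" for i
  define prev where "prev i = (if i = 0 then m - 1 else i - 1)" for i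
  define succ where "succ i = (if i = m - 1 then 0 else i + 1)" for i
  have m: "3 \<le> m" using len by (simp add: m_def)
  have arc: "(x (prev i), x i) \<in> parcs G" if "i < m" for i
  proof -
    have "es \<noteq> []" using len by auto
    then have "fst (es ! i) = x (prev i)"
      using pcas_nth[OF es(2), of i] pcas_last[OF es(2)] that by (auto simp: x_def prev_def m_def)
    moreover have "es ! i \<in> parcs G" using es(1) that by (auto simp: m_def)
    ultimately show ?thesis by (metis x_def prod.collapse)
  qed
  have "\<exists>i\<in>{..<m}. \<forall>j\<in>{..<m}. D (x j) \<le> D (x i)"
  proof -
    have "finite ((\<lambda>i. D (x i)) ` {..<m})" "(\<lambda>i. D (x i)) ` {..<m} \<noteq> {}"
      using m by (auto simp: lessThan_empty_iff)
    from Max_in[OF this] Max_ge[OF this(1)] show ?thesis by force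
  qed
  then obtain i where i: "i < m" and max: "\<And>j. j < m \<Longrightarrow> D (x j) \<le> D (x i)"
    by auto
  have lt: "prev i < m" "succ i < m" "prev (succ i) = i" "prev i \<noteq> succ i"
    using i m by (auto simp: prev_def succ_def)
  have "x (prev i) \<noteq> x (succ i)"
    using es(3) lt nth_eq_iff_index_eq[of "map snd es" "prev i" "succ i"] by (simp add: x_def m_def)
  then show ?thesis
    using arc[OF i] arc[OF lt(2)] max lt by metis
qed

text \<open>\<open>D\<close> grows by at most one along each arc, which bounds every walk from
  below; following \<open>step\<close> back from \<open>v\<close> builds a walk of length
  \<open>D v\<close>.\<close>

lemma graph_dist_eqI:
  assumes "r \<in> pverts G" "D r = 0"
    and le: "\<And>u v. (u, v) \<in> parcs G \<Longrightarrow> D v \<le> Suc (D u)"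
    and step: "\<And>v. v \<in> pverts G \<Longrightarrow> v \<noteq> r \<Longrightarrow> \<exists>u\<in>pverts G. (u, v) \<in> parcs G \<and> D v = Suc (D u)"
    and "v \<in> pverts G"
  shows "graph_dist G r v = D v"
  unfolding graph_dist_def awalk_with_proj_iff
proof (rule Least_equality)
  show "\<exists>es. (r \<in> pverts G \<and> set es \<subseteq> parcs G \<and> pcas r es v) \<and> length es = D v"
    using \<open>v \<in> pverts G\<close>
  proof (induction "D v" arbitrary: v rule: less_induct)
    case less
    show ?case
    proof (cases "v = r")
      case True
      then show ?thesis using assms(1,2) by (intro exI[of _ "[]"]) auto
    next
      case False
      then obtain u where u: "u \<in> pverts G" "(u, v) \<in> parcs G" "D v = Suc (D u)"
        using step less.prems by blast
      then obtain es where "set es \<subseteq> parcs G \<and> pcas r es u" "length es = D u"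
        using less.hyps[of u] by auto
      then show ?thesis
        using u assms(1) by (intro exI[of _ "es @ [(u, v)]"]) (auto simp: pcas_append)
    qed
  qed
  fix k assume "\<exists>es. (r \<in> pverts G \<and> set es \<subseteq> parcs G \<and> pcas r es v) \<and> length es = k"
  then obtain es where es: "set es \<subseteq> parcs G" "pcas r es v" "length es = k" by blast
  have "D v \<le> D u + length es" if "set es \<subseteq> parcs G" "pcas u es v" for u
    using that
  proof (induction es arbitrary: u)
    case (Cons e es)
    then have "D v \<le> D (snd e) + length es" "D (snd e) \<le> Suc (D u)"
      using le[of "fst e" "snd e"] by auto
    then show ?case by simp
  qed simp
  with es assms(2) show "D v \<le> k" by fastforce
qed

section \<open>The graph of a parent map is a rooted tree\<close>

context
  fixes V :: "'a set" and r :: 'a and p :: "'a \<Rightarrow> 'a" and G :: "'a pair_pre_digraph"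
  assumes finite_V: "finite V" and t: "parent_tree V r p"
  defines "G \<equiv> snd (tree_graph V (r, p))"
begin

lemma pverts_tree_graph: "pverts G = V"
  by (simp add: G_def tree_graph_def)

lemma parcs_tree_graph: "(u, v) \<in> parcs G \<longleftrightarrow>
    (u \<in> V \<and> u \<noteq> r \<and> v = p u) \<or> (v \<in> V \<and> v \<noteq> r \<and> u = p v)"
  by (auto simp: G_def tree_graph_def)

lemma graph_dist_tree_graph:
  assumes "v \<in> V"
  shows "graph_dist G r v = depth r p v"
proof (rule graph_dist_eqI)
  show "r \<in> pverts G" using parent_treeD[OF t] by (simp add: pverts_tree_graph)
  show "v \<in> pverts G" using assms by (simp add: pverts_tree_graph)
  show "depth r p v \<le> Suc (depth r p u)" if "(u, v) \<in> parcs G" for u v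
    using that depth_step[OF t, of u] depth_step[OF t, of v] by (auto simp: parcs_tree_graph)
  show "\<exists>u\<in>pverts G. (u, v) \<in> parcs G \<and> depth r p v = Suc (depth r p u)"
    if "v \<in> pverts G" "v \<noteq> r" for v
    using that depth_step[OF t, of v] parent_treeD(4)[OF t, of v]
    by (intro bexI[of _ "p v"]) (auto simp: pverts_tree_graph parcs_tree_graph)
qed simp

lemma children_tree_graph: "children (r, G) u = kids V r p u"
proof -
  have "v \<in> children (r, G) u \<longleftrightarrow> v \<in> kids V r p u" for v
  proof
    assume "v \<in> children (r, G) u"
    then have arc: "(u, v) \<in> parcs G" and dist: "graph_dist G r v = graph_dist G r u + 1"
      by (auto simp: children_def)
    from arc consider "u \<in> V" "u \<noteq> r" "v = p u" | "v \<in> V" "v \<noteq> r" "u = p v"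
      unfolding parcs_tree_graph by blast
    then show "v \<in> kids V r p u"
    proof cases
      case 1
      then have "graph_dist G r u = Suc (graph_dist G r v)"
        using depth_step[OF t 1(1,2)] parent_treeD(4)[OF t 1(1)] by (simp add: graph_dist_tree_graph)
      with dist show ?thesis by simp
    next
      case 2
      then show ?thesis by (simp add: kids_def)
    qed
  next
    assume "v \<in> kids V r p u"
    then have v: "v \<in> V" "v \<noteq> r" "u = p v" by (auto simp: kids_def)
    then show "v \<in> children (r, G) u"
      using depth_step[OF t v(1,2)] parent_treeD(4)[OF t v(1)]
      by (simp add: children_def parcs_tree_graph graph_dist_tree_graph)
  qed
  then show ?thesis by blast
qed

lemma pair_graph_tree_graph: "pair_graph G"
proof
  show "finite (pverts G)" using finite_V by (simp add: pverts_tree_graph)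
  show "finite (parcs G)" using finite_V by (simp add: G_def tree_graph_def)
  show "symmetric (with_proj G)"
    by (auto simp: symmetric_def sym_def parcs_tree_graph)
  fix e assume e: "e \<in> parcs G"
  obtain u v where uv: "e = (u, v)" by fastforce
  have "p w \<in> V \<and> p w \<noteq> w" if "w \<in> V" "w \<noteq> r" for w
    using parent_treeD(4)[OF t that(1)] depth_step[OF t that] by (metis n_not_Suc_n)
  then have "u \<in> V \<and> v \<in> V \<and> u \<noteq> v"
    using e unfolding uv parcs_tree_graph by metis
  then show "fst e \<in> pverts G" "snd e \<in> pverts G" "fst e \<noteq> snd e"
    by (auto simp: uv pverts_tree_graph)
qed

lemma undirected_tree_tree_graph: "undirected_tree G"
proof -
  interpret pair_graph G by (rule pair_graph_tree_graph)
  have reach: "v \<rightarrow>\<^sup>*\<^bsub>with_proj G\<^esub> r" if "v \<in> V" for v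
    using t that
  proof (induction rule: parent_tree_induct)
    case root
    then show ?case using parent_treeD[OF t] by (simp add: pverts_tree_graph)
  next
    case (step v)
    then have "(v, p v) \<in> parcs G" by (simp add: parcs_tree_graph)
    then show ?case using step.IH by (metis adj_reachable_trans with_proj_simps(3))
  qed
  have "u \<rightarrow>\<^sup>*\<^bsub>with_proj G\<^esub> v" if "u \<in> V" "v \<in> V" for u v
    using reach[OF that(1)] symmetric_reachable[OF sym_arcs reach[OF that(2)]] by (rule reachable_trans)
  then have "Digraph_Component.connected (with_proj G)"
    using parent_treeD(1)[OF t]
    unfolding Digraph_Component.connected_def strongly_connected_def
    by (auto simp: reachable_mk_symmetric_eq[OF sym_arcs] pverts_tree_graph)
  moreover have False if cyc: "pre_digraph.cycle (with_proj G) es" "3 \<le> length es" for es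
  proof -
    obtain a b c where abc: "a \<noteq> c" "(a, b) \<in> parcs G" "(b, c) \<in> parcs G"
      "depth r p a \<le> depth r p b" "depth r p c \<le> depth r p b"
      using ex_peak_of_cycle[OF cyc, of "depth r p"] by blast
    \<comment> \<open>Of the neighbours of \<open>b\<close>, the children are deeper, so one that is
      not deeper is the parent.\<close>
    have "a = p b"
      using abc(2,4) depth_step[OF t, of a] unfolding parcs_tree_graph by fastforce
    moreover have "c = p b"
      using abc(3,5) depth_step[OF t, of c] unfolding parcs_tree_graph by fastforce
    ultimately show False using abc(1) by simp
  qed
  ultimately show ?thesis
    unfolding undirected_tree_def using pair_graph_tree_graph by blast
qed

lemma tree_height_tree_graph: "tree_height (r, G) \<le> h \<longleftrightarrow> height_le V h (r, p)"
proof -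
  have "graph_dist G r ` pverts G = depth r p ` V"
    using graph_dist_tree_graph by (auto simp: pverts_tree_graph)
  moreover have "V \<noteq> {}" using parent_treeD(1)[OF t] by blast
  ultimately show ?thesis
    using finite_V by (simp add: tree_height_def height_le_def)
qed

end

text \<open>The children, computed from distances in the graph, determine the parent of each
  non-root vertex.\<close>

lemma tree_graph_inj:
  assumes "finite V" "parent_tree V r p" "parent_tree V r' p'"
    and eq: "tree_graph V (r, p) = tree_graph V (r', p')"
  shows "(r, p) = (r', p')"
proof -
  have r: "r = r'" using eq by (simp add: tree_graph_def)
  have "kids V r p u = kids V r p' u" for u
    using children_tree_graph[OF assms(1,2), of u] children_tree_graph[OF assms(1,3), of u]
    unfolding eq by (simp add: r)
  then have "p v = p' v" if "v \<in> V - {r}" for v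
    using that unfolding kids_def by blast
  moreover have "p v = p' v" if "v \<notin> V - {r}" for v
    using that assms(2,3) r by (simp add: parent_tree_def)
  ultimately show ?thesis using r by blast
qed

section \<open>Every rooted tree comes from a parent map\<close>

text \<open>Climb from \<open>u\<close> and \<open>v\<close> simultaneously until the two paths
  first meet, after \<open>k\<close> steps. The two paths and the arc from \<open>u\<close> to
  \<open>v\<close> form a cycle of length \<open>2 * k + 1\<close>.\<close>

lemma cycle_of_level_arc:
  fixes D :: "'a \<Rightarrow> nat"
  assumes pV: "\<And>v. v \<in> pverts G \<Longrightarrow> p v \<in> pverts G"
    and arc: "\<And>v. v \<in> pverts G \<Longrightarrow> 0 < D v \<Longrightarrow> (v, p v) \<in> parcs G \<and> (p v, v) \<in> parcs G \<and> D v = Suc (D (p v))"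
    and root: "\<And>v. v \<in> pverts G \<Longrightarrow> D v = 0 \<Longrightarrow> v = r"
    and uv: "(u, v) \<in> parcs G" "u \<in> pverts G" "v \<in> pverts G" "u \<noteq> v" "D u = D v"
  shows "\<exists>es. pre_digraph.cycle (with_proj G) es \<and> 3 \<le> length es"
proof -
  have anc: "(p ^^ i) w \<in> pverts G \<and> D ((p ^^ i) w) = D w - i" if "w \<in> pverts G" "i \<le> D w" for w i
    using that(2)
  proof (induction i)
    case 0
    then show ?case using that(1) by simp
  next
    case (Suc i)
    then show ?case using arc[of "(p ^^ i) w"] pV by auto
  qed
  define k where "k = (LEAST i. (p ^^ i) u = (p ^^ i) v)"
  \<comment> \<open>After \<open>D u\<close> steps both paths are on level 0, hence at
    \<open>r\<close>; so \<open>k\<close> is well defined.\<close>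
  have "(p ^^ D u) u = (p ^^ D u) v"
    using root anc[OF uv(2), of "D u"] anc[OF uv(3), of "D v"] uv(5) by (metis diff_self_eq_0 order_refl)
  then have k: "(p ^^ k) u = (p ^^ k) v" "k \<le> D u" and less: "i < k \<Longrightarrow> (p ^^ i) u \<noteq> (p ^^ i) v" for i
    unfolding k_def by (auto intro: LeastI Least_le dest: not_less_Least)
  have "0 < k" using k(1) uv(4) by (cases k) auto
  \<comment> \<open>The cycle starts at the meeting point, goes down to \<open>u\<close>, across to
    \<open>v\<close> and up again.\<close>
  define up where "up = map (\<lambda>i. ((p ^^ i) v, (p ^^ Suc i) v)) [0..<k]"
  define down where "down = map (\<lambda>i. ((p ^^ Suc i) u, (p ^^ i) u)) (rev [0..<k])"
  have cas_up: "pcas w (map (\<lambda>i. ((p ^^ i) w, (p ^^ Suc i) w)) [0..<j]) ((p ^^ j) w)" for w j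
    by (induction j) (auto simp: pcas_append)
  have cas_down: "pcas ((p ^^ j) w) (map (\<lambda>i. ((p ^^ Suc i) w, (p ^^ i) w)) (rev [0..<j])) w" for w j
    by (induction j) auto
  have arcs: "((p ^^ i) w, (p ^^ Suc i) w) \<in> parcs G \<and> ((p ^^ Suc i) w, (p ^^ i) w) \<in> parcs G"
    if "i < k" "w = u \<or> w = v" for i w
    using arc[of "(p ^^ i) w"] anc[of w i] that k(2) uv by auto
  have "set (down @ (u, v) # up) \<subseteq> parcs G"
    using arcs uv(1) by (auto simp: down_def up_def simp del: funpow.simps)
  moreover have "pcas ((p ^^ k) u) (down @ (u, v) # up) ((p ^^ k) u)"
    using cas_down[of k u] cas_up[of v k] k(1) unfolding pcas_append down_def up_def by auto
  moreover have "distinct (map snd (down @ (u, v) # up))"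
  proof -
    \<comment> \<open>The head \<open>v\<close> of the crossing arc completes the heads of
      \<open>up\<close> to the whole path from \<open>v\<close>, with indices 0 to
      \<open>k\<close>.\<close>
    have "[0..<Suc k] = 0 # map Suc [0..<k]"
      unfolding map_Suc_upt by (rule upt_conv_Cons) simp
    then have "v # map snd up = map (\<lambda>i. (p ^^ i) v) [0..<Suc k]"
      by (simp add: up_def comp_def del: upt_Suc)
    then have eq: "map snd (down @ (u, v) # up) =
        map (\<lambda>i. (p ^^ i) u) (rev [0..<k]) @ map (\<lambda>i. (p ^^ i) v) [0..<Suc k]"
      by (simp add: down_def comp_def)
    \<comment> \<open>Levels fall by one per step, so equal vertices have equal indices. A
      coincidence between the two paths would then contradict the minimality of
      \<open>k\<close>.\<close>
    have same: "i = j" if "(p ^^ i) w = (p ^^ j) w'" "i \<le> k" "j \<le> k" "w = u \<or> w = v" "w' = u \<or> w' = v"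
      for i j w w'
    proof -
      have "D w - i = D w' - j" "D w = D u" "D w' = D u"
        using anc[of w i] anc[of w' j] that k(2) uv by auto
      then show ?thesis using that(2,3) k(2) by linarith
    qed
    show ?thesis
      unfolding eq distinct_append distinct_map
    proof (intro conjI)
      show "inj_on (\<lambda>i. (p ^^ i) u) (set (rev [0..<k]))"
        by (rule inj_onI, rule same) auto
      show "inj_on (\<lambda>i. (p ^^ i) v) (set [0..<Suc k])"
        by (rule inj_onI, rule same) auto
      show "set (map (\<lambda>i. (p ^^ i) u) (rev [0..<k])) \<inter> set (map (\<lambda>i. (p ^^ i) v) [0..<Suc k]) = {}"
      proof (rule equals0I)
        fix a assume "a \<in> set (map (\<lambda>i. (p ^^ i) u) (rev [0..<k])) \<inter> set (map (\<lambda>i. (p ^^ i) v) [0..<Suc k])"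
        then have "\<exists>i<k. a = (p ^^ i) u" "\<exists>j\<le>k. a = (p ^^ j) v"
          by (auto simp: less_Suc_eq_le simp del: upt_Suc)
        then obtain i j where ij: "i < k" "j \<le> k" "a = (p ^^ i) u" "a = (p ^^ j) v" by blast
        then have "i = j" using same[of i u j v] by auto
        then show False using ij less[of i] by metis
      qed
    qed auto
  qed
  moreover have "(p ^^ k) u \<in> pverts G" using anc[OF uv(2) k(2)] by blast
  ultimately have "pre_digraph.cycle (with_proj G) (down @ (u, v) # up)"
    unfolding cycle_with_proj_iff by blast
  moreover have "3 \<le> length (down @ (u, v) # up)"
    using \<open>0 < k\<close> by (simp add: down_def up_def)
  ultimately show ?thesis by blast
qed

text \<open>Connectivity provides shortest walks from the root; appending an arc to one or removing
  its last arc gives the local properties of the distance from which a parent map is built.\<close>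

lemma undirected_treeD:
  assumes T: "undirected_tree G" and r: "r \<in> pverts G"
  shows "graph_dist G r r = 0"
    and "(u, v) \<in> parcs G \<Longrightarrow> graph_dist G r v \<le> Suc (graph_dist G r u)"
    and "v \<in> pverts G \<Longrightarrow> v \<noteq> r \<Longrightarrow> \<exists>u\<in>pverts G. (u, v) \<in> parcs G \<and> graph_dist G r v = Suc (graph_dist G r u)"
proof -
  interpret pair_graph G using T by (simp add: undirected_tree_def)
  have conn: "strongly_connected (with_proj G)"
    using T by (intro symmetric_connected_imp_strongly_connected sym_arcs) (simp add: undirected_tree_def)
  define walk where "walk es v \<longleftrightarrow> set es \<subseteq> parcs G \<and> pcas r es v" for es v
  have dist: "graph_dist G r v = (LEAST k. \<exists>es. walk es v \<and> length es = k)" for v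
    unfolding graph_dist_def awalk_with_proj_iff walk_def using r by simp
  have le: "graph_dist G r v \<le> length es" if "walk es v" for v es
    unfolding dist using that by (intro Least_le) blast
  have ex: "\<exists>es. walk es v \<and> length es = graph_dist G r v" if v: "v \<in> pverts G" for v
  proof -
    have "r \<rightarrow>\<^sup>*\<^bsub>with_proj G\<^esub> v"
      using conn r v by (simp add: strongly_connected_def)
    then obtain es where "walk es v"
      unfolding reachable_awalk using awalk_with_proj_iff[of G] by (auto simp: walk_def)
    then have "\<exists>k es. walk es v \<and> length es = k" by blast
    from LeastI_ex[OF this] show ?thesis unfolding dist .
  qed
  show "graph_dist G r r = 0"
    using le[of "[]" r] by (simp add: walk_def)
  show *: "graph_dist G r v \<le> Suc (graph_dist G r u)" if uv: "(u, v) \<in> parcs G" for u v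
  proof -
    obtain es where "walk es u" "length es = graph_dist G r u"
      using ex[of u] in_arcsD1[OF uv] by blast
    moreover have "walk (es @ [(u, v)]) v"
      using \<open>walk es u\<close> uv unfolding walk_def pcas_append by (intro conjI exI[of _ u]) auto
    ultimately show ?thesis
      using le[of "es @ [(u, v)]" v] by simp
  qed
  show "\<exists>u\<in>pverts G. (u, v) \<in> parcs G \<and> graph_dist G r v = Suc (graph_dist G r u)"
    if v: "v \<in> pverts G" "v \<noteq> r"
  proof -
    obtain es where es: "walk es v" "length es = graph_dist G r v"
      using ex[OF v(1)] by blast
    have "es \<noteq> []" using es(1) v(2) by (auto simp: walk_def)
    then obtain fs e where "es = fs @ [e]" by (metis rev_exhaust)
    then obtain u where u: "(u, v) \<in> parcs G" "walk fs u" "Suc (length fs) = graph_dist G r v"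
      using es by (cases e) (auto simp: walk_def pcas_append)
    then show ?thesis
      using le[OF u(2)] *[OF u(1)] in_arcsD1[OF u(1)] by (intro bexI[of _ u]) auto
  qed
qed

text \<open>The children of all vertices together are counted by \<open>n - 1\<close>, so every vertex other than the root
  is a child of exactly one vertex; an arc within one level would close an odd cycle.\<close>

lemma degree_trees_surj:
  assumes d: "d \<in> degree_sequences n" and T: "(r, G) \<in> degree_trees d"
  shows "(r, G) \<in> tree_graph {1..n} ` parent_trees {1..n} (\<lambda>i. d ! (i - 1))"
proof -
  define V where "V = {1..n}"
  define D where "D = graph_dist G r"
  define ch where "ch = children (r, G)"
  have n: "length d = n" "sum_list d + 1 = n"
    using d by (auto simp: degree_sequences_def)
  have ut: "undirected_tree G" and V: "pverts G = V" and r: "r \<in> pverts G"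
    and deg: "\<And>u. u \<in> V \<Longrightarrow> card (ch u) = d ! (u - 1)"
    using T n by (auto simp: degree_trees_def rooted_tree_def V_def ch_def)
  interpret pair_graph G using ut by (simp add: undirected_tree_def)
  note U = undirected_treeD[OF ut r, folded D_def]
  have ch_iff: "v \<in> ch u \<longleftrightarrow> (u, v) \<in> parcs G \<and> D v = Suc (D u)" for u v
    by (simp add: ch_def children_def D_def)
  have finV: "finite V" by (simp add: V_def)
  have chV: "ch u \<subseteq> V - {r}" for u
    using ch_iff U(1) in_arcsD2 V by fastforce
  have fin_ch: "finite (ch u)" for u
    using chV finV by (meson finite_Diff finite_subset)
  have sum: "(\<Sum>u\<in>V. d ! (u - 1)) = n - 1"
  proof -
    have "(\<Sum>u\<in>V. d ! (u - 1)) = (\<Sum>i<n. d ! i)"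
      unfolding V_def by (rule sum.reindex_bij_witness[of _ Suc "\<lambda>i. i - 1"]) auto
    then show ?thesis using n by (simp add: sum_list_sum_nth atLeast0LessThan)
  qed
  define E where "E = Sigma V ch"
  have cardE: "card E = n - 1"
    unfolding E_def using finV fin_ch sum deg by (subst card_SigmaI) auto
  have sndE: "snd ` E = V - {r}"
  proof
    show "snd ` E \<subseteq> V - {r}" using chV unfolding E_def by force
    show "V - {r} \<subseteq> snd ` E"
    proof
      fix v assume "v \<in> V - {r}"
      then obtain u where "u \<in> V" "v \<in> ch u"
        using U(3)[of v] V by (auto simp: ch_iff)
      then have "(u, v) \<in> E" by (simp add: E_def)
      then show "v \<in> snd ` E" by (metis image_eqI snd_conv)
    qed
  qed
  have finE: "finite E" unfolding E_def using finV fin_ch by blast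
  have "card (snd ` E) = card E"
    using r V finV cardE unfolding sndE by (simp add: V_def)
  then have injE: "inj_on snd E" by (rule eq_card_imp_inj_on[OF finE])
  define p where "p v = (if v \<in> V - {r} then (SOME u. u \<in> V \<and> v \<in> ch u) else v)" for v
  have p: "p v \<in> V \<and> v \<in> ch (p v)" if "v \<in> V" "v \<noteq> r" for v
  proof -
    have "\<exists>u. u \<in> V \<and> v \<in> ch u"
      using that U(3)[of v] V by (auto simp: ch_iff)
    from someI_ex[OF this] show ?thesis using that by (simp add: p_def)
  qed
  have p_unique: "u = p v" if "v \<in> ch u" for u v
  proof -
    have "u \<in> V" "v \<in> V" "v \<noteq> r"
      using that chV[of u] ch_iff in_arcsD1 V by auto
    then have "(u, v) \<in> E" "(p v, v) \<in> E"
      using that p by (auto simp: E_def)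
    then show ?thesis using inj_onD[OF injE] by fastforce
  qed
  have t: "parent_tree V r p"
    by (rule parent_treeI[where D = D]) (use p r V ch_iff in \<open>auto simp: p_def\<close>)
  have kids: "kids V r p u = ch u" for u
    using p p_unique chV[of u] by (auto simp: kids_def)
  have root: "v = r" if "v \<in> V" "D v = 0" for v
    using that U(3)[of v] V by auto
  have up: "(v, p v) \<in> parcs G \<and> (p v, v) \<in> parcs G \<and> D v = Suc (D (p v))"
    if "v \<in> V" "v \<noteq> r" for v
    using p[OF that] by (auto simp: ch_iff intro: arcs_symmetric)
  have "(u, v) \<in> parcs G \<longleftrightarrow> (u \<in> V \<and> u \<noteq> r \<and> v = p u) \<or> (v \<in> V \<and> v \<noteq> r \<and> u = p v)" for u v
  proof
    assume uv: "(u, v) \<in> parcs G"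
    then have vu: "(v, u) \<in> parcs G" by (rule arcs_symmetric)
    have mem: "u \<in> V" "v \<in> V" using uv in_arcsD1 in_arcsD2 V by auto
    have "D u \<noteq> D v"
    proof
      assume eq: "D u = D v"
      have "\<exists>es. pre_digraph.cycle (with_proj G) es \<and> 3 \<le> length es"
      proof (rule cycle_of_level_arc)
        show "p w \<in> pverts G" if "w \<in> pverts G" for w
          using parent_treeD(4)[OF t] that unfolding V .
        show "(w, p w) \<in> parcs G \<and> (p w, w) \<in> parcs G \<and> D w = Suc (D (p w))"
          if "w \<in> pverts G" "0 < D w" for w
        proof -
          have "w \<noteq> r" using that(2) U(1) by (metis less_irrefl)
          then show ?thesis using up[of w] that(1) unfolding V by blast
        qed
        show "w = r" if "w \<in> pverts G" "D w = 0" for w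
          using root that unfolding V by blast
        show "u \<in> pverts G" "v \<in> pverts G" using mem V by auto
        show "u \<noteq> v" using uv no_loops' by blast
      qed (fact uv eq)+
      then show False using ut by (auto simp: undirected_tree_def)
    qed
    \<comment> \<open>Levels of adjacent vertices differ by at most one and now are distinct, so
      every arc joins a vertex to one of its children.\<close>
    then have "D v = Suc (D u) \<or> D u = Suc (D v)"
      using U(2)[OF uv] U(2)[OF vu] by auto
    then have "v \<in> ch u \<or> u \<in> ch v"
      using uv vu by (auto simp: ch_iff)
    then show "(u \<in> V \<and> u \<noteq> r \<and> v = p u) \<or> (v \<in> V \<and> v \<noteq> r \<and> u = p v)"
      using chV p_unique by blast
  next
    assume "(u \<in> V \<and> u \<noteq> r \<and> v = p u) \<or> (v \<in> V \<and> v \<noteq> r \<and> u = p v)"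
    then show "(u, v) \<in> parcs G" using up by blast
  qed
  then have "parcs G = parcs (snd (tree_graph V (r, p)))"
    using parcs_tree_graph[OF finV t] by (auto intro: set_eqI)
  then have "(r, G) = tree_graph V (r, p)"
    using V by (simp add: tree_graph_def pair_pre_digraph.equality)
  moreover have "(r, p) \<in> parent_trees V (\<lambda>i. d ! (i - 1))"
    using t deg by (simp add: parent_trees_def kids)
  ultimately show ?thesis unfolding V_def by blast
qed

lemma bij_betw_tree_graph:
  assumes d: "d \<in> degree_sequences n"
  shows "bij_betw (tree_graph {1..n}) (parent_trees {1..n} (\<lambda>i. d ! (i - 1))) (degree_trees d)"
proof (rule bij_betw_imageI)
  have n: "length d = n" using d by (simp add: degree_sequences_def)
  show "inj_on (tree_graph {1..n}) (parent_trees {1..n} (\<lambda>i. d ! (i - 1)))"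
    using tree_graph_inj[of "{1..n}"] by (force simp: inj_on_def parent_trees_def)
  have "tree_graph {1..n} (r, p) \<in> degree_trees d"
    if "(r, p) \<in> parent_trees {1..n} (\<lambda>i. d ! (i - 1))" for r p
  proof -
    have t: "parent_tree {1..n} r p" using that by (simp add: parent_trees_def)
    note F = finite_atLeastAtMost[of 1 n]
    have "tree_graph {1..n} (r, p) = (r, snd (tree_graph {1..n} (r, p)))"
      by (simp add: tree_graph_def)
    then show ?thesis
      using that undirected_tree_tree_graph[OF F t] children_tree_graph[OF F t]
        pverts_tree_graph[OF F t] parent_treeD(1)[OF t] n
      by (auto simp: degree_trees_def rooted_tree_def parent_trees_def)
  qed
  then have "tree_graph {1..n} ` parent_trees {1..n} (\<lambda>i. d ! (i - 1)) \<subseteq> degree_trees d"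
    by (auto simp del: One_nat_def)
  moreover have "degree_trees d \<subseteq> tree_graph {1..n} ` parent_trees {1..n} (\<lambda>i. d ! (i - 1))"
    using degree_trees_surj[OF d] by (simp only: subset_iff split_paired_All) blast
  ultimately show "tree_graph {1..n} ` parent_trees {1..n} (\<lambda>i. d ! (i - 1)) = degree_trees d"
    by (rule equalityI)
qed

lemma card_degree_trees_height_le:
  assumes d: "d \<in> degree_sequences n"
  shows "card {t \<in> degree_trees d. tree_height t \<le> h} = card (low_trees {1..n} (\<lambda>i. d ! (i - 1)) h)"
proof -
  let ?P = "parent_trees {1..n} (\<lambda>i. d ! (i - 1))"
  note b = bij_betw_tree_graph[OF d]
  have height: "tree_height (tree_graph {1..n} t) \<le> h \<longleftrightarrow> height_le {1..n} h t" if "t \<in> ?P" for t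
  proof -
    obtain r p where t: "t = (r, p)" by fastforce
    then have "parent_tree {1..n} r p" using that by (simp add: parent_trees_def)
    from tree_height_tree_graph[OF finite_atLeastAtMost this, of h] show ?thesis
      by (simp add: t tree_graph_def)
  qed
  have "{t \<in> degree_trees d. tree_height t \<le> h} = tree_graph {1..n} ` low_trees {1..n} (\<lambda>i. d ! (i - 1)) h"
    unfolding bij_betw_imp_surj_on[OF b, symmetric] low_trees_def using height by blast
  moreover have "inj_on (tree_graph {1..n}) (low_trees {1..n} (\<lambda>i. d ! (i - 1)) h)"
    using bij_betw_imp_inj_on[OF b] by (rule inj_on_subset) (auto simp: low_trees_def)
  ultimately show ?thesis by (simp add: card_image)
qed

section \<open>Covering steps and stochastic order\<close>

lemma height_cdf_cong:
  assumes "\<And>u. u \<in> V \<Longrightarrow> f u = g u"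
  shows "height_cdf V f h = height_cdf V g h"
proof -
  have "parent_trees V f = parent_trees V g"
    using assms by (auto simp: parent_trees_def)
  then show ?thesis by (simp add: height_cdf_def low_trees_def)
qed

definition list_cdf :: "nat list \<Rightarrow> nat \<Rightarrow> real" where
  "list_cdf d h = height_cdf {1..length d} (\<lambda>i. d ! (i - 1)) h"

text \<open>Rearranging the entries amounts to relabelling the vertices, so any representative of an
  equivalence class may be used.\<close>

lemma list_cdf_mset:
  assumes "mset d = mset e"
  shows "list_cdf d h = list_cdf e h"
proof -
  define n where "n = length e"
  obtain \<sigma> where \<sigma>: "\<sigma> permutes {..<n}" "permute_list \<sigma> e = d"
    using mset_eq_permutation[OF assms] unfolding n_def by blast
  \<comment> \<open>\<open>\<sigma>\<close> permutes the list positions from 0; \<open>\<pi>\<close>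
    is its shift to the vertices from 1.\<close>
  define \<pi> where "\<pi> i = (if i \<in> {1..n} then Suc (\<sigma> (i - 1)) else i)" for i
  have lt: "\<sigma> j < n \<longleftrightarrow> j < n" "inv \<sigma> j < n \<longleftrightarrow> j < n" for j
    using permutes_in_image[OF \<sigma>(1)] permutes_in_image[OF permutes_inv[OF \<sigma>(1)]] by simp_all
  have "bij_betw \<pi> {1..n} {1..n}"
    by (rule bij_betw_byWitness[where f' = "\<lambda>i. Suc (inv \<sigma> (i - 1))"])
      (use lt permutes_inverses[OF \<sigma>(1)] in \<open>auto simp: \<pi>_def Suc_le_eq\<close>)
  then have \<pi>: "\<pi> permutes {1..n}"
    by (rule bij_imp_permutes) (unfold \<pi>_def, rule if_not_P)
  have len: "length d = n"
    using \<sigma>(2) by (auto simp: n_def)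
  have "d ! (i - 1) = ((\<lambda>i. e ! (i - 1)) \<circ> \<pi>) i" if "i \<in> {1..n}" for i
    using that \<sigma> permute_list_nth[of \<sigma> e "i - 1"] by (auto simp: \<pi>_def n_def)
  then have "list_cdf d h = height_cdf {1..n} ((\<lambda>i. e ! (i - 1)) \<circ> \<pi>) h"
    unfolding list_cdf_def len by (rule height_cdf_cong)
  then show ?thesis
    using height_cdf_permute[OF _ \<pi>] by (simp add: list_cdf_def n_def)
qed

lemma degree_classesD:
  assumes "D \<in> degree_classes n" "d \<in> D" "e \<in> D"
  shows "d \<in> degree_sequences n" "mset d = mset e"
  using assms by (auto simp: degree_classes_def degree_equiv_def elim!: quotientE)

lemma card_nonzero_mset:
  assumes "mset d = mset e"
  shows "card {i. i < length d \<and> d ! i \<noteq> 0} = card {i. i < length e \<and> e ! i \<noteq> 0}"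
proof -
  have "length (filter (\<lambda>k. k \<noteq> 0) d) = length (filter (\<lambda>k. k \<noteq> 0) e)"
    using assms by (metis mset_filter size_mset)
  then show ?thesis by (simp add: length_filter_conv_card)
qed

text \<open>The representatives \<open>e\<close> and \<open>e'\<close> that witness the covering
  differ by the transfer of one child from vertex 2 to vertex 1, with \<open>b\<close> being
  \<open>e' ! 1\<close>.\<close>

lemma list_cdf_cover:
  assumes "(D, D') \<in> cover_rel n" and d: "d \<in> D" and d': "d' \<in> D'"
  shows "list_cdf d h \<le> list_cdf d' h"
    and "3 \<le> card {i. i < n \<and> d ! i \<noteq> 0} \<Longrightarrow> \<exists>h. list_cdf d h < list_cdf d' h"
proof -
  have D: "D \<in> degree_classes n" "D' \<in> degree_classes n" and n: "2 \<le> n"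
    using assms(1) by (auto simp: cover_rel_def covers_def)
  obtain e e' where e: "e \<in> D" "e' \<in> D'" "e ! 1 \<le> e ! 0" "e' ! 0 = e ! 0 + 1" "e' ! 1 + 1 = e ! 1"
    and same: "\<And>k. 2 \<le> k \<Longrightarrow> k < n \<Longrightarrow> e' ! k = e ! k"
    using assms(1) by (auto simp: cover_rel_def covers_def)
  have es: "e \<in> degree_sequences n" "e' \<in> degree_sequences n"
    and ms: "mset d = mset e" "mset d' = mset e'"
    using degree_classesD(1)[OF D(1) e(1) d] degree_classesD(1)[OF D(2) e(2) d']
      degree_classesD(2)[OF D(1) d e(1)] degree_classesD(2)[OF D(2) d' e(2)] by auto
  have len: "length e = n" "length e' = n" "length d = n"
    using es ms(1) by (auto simp: degree_sequences_def dest: mset_eq_length)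
  define deg where "deg i = e ! (i - 1)" for i
  interpret transfer_child "{1..n}" 1 2 deg "e' ! 1"
    by unfold_locales (use n e in \<open>auto simp: deg_def\<close>)
  have "e' ! (i - 1) = deg' i" if "i \<in> {1..n}" for i
    using that e same[of "i - 1"] by (auto simp: deg_def)
  then have cdf': "list_cdf d' h = height_cdf {1..n} deg' h" for h
    unfolding list_cdf_mset[OF ms(2)] unfolding list_cdf_def len by (rule height_cdf_cong)
  have cdf: "list_cdf d h = height_cdf {1..n} deg h" for h
    unfolding list_cdf_mset[OF ms(1)] unfolding list_cdf_def len deg_def ..
  show "list_cdf d h \<le> list_cdf d' h"
    unfolding cdf cdf' by (rule height_cdf_le)
  assume "3 \<le> card {i. i < n \<and> d ! i \<noteq> 0}"
  then have card3: "3 \<le> card {i. i < n \<and> e ! i \<noteq> 0}"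
    using card_nonzero_mset[OF ms(1)] len by simp
  \<comment> \<open>Three non-leaves leave one apart from the vertices 1 and 2, at list positions 0
    and 1.\<close>
  have "\<not> {i. i < n \<and> e ! i \<noteq> 0} \<subseteq> {0, 1}"
  proof
    assume "{i. i < n \<and> e ! i \<noteq> 0} \<subseteq> {0, 1}"
    then have "card {i. i < n \<and> e ! i \<noteq> 0} \<le> card {0, 1 :: nat}"
      by (intro card_mono) auto
    with card3 show False by simp
  qed
  then obtain i where i: "i < n" "e ! i \<noteq> 0" "i \<noteq> 0" "i \<noteq> 1" by auto
  have sum_eq: "(\<Sum>u\<in>{1..n}. deg u) = (\<Sum>i<n. e ! i)"
    by (rule sum.reindex_bij_witness[of _ Suc "\<lambda>i. i - 1"]) (auto simp: deg_def)
  have "sum deg {1..n} + 1 = card {1..n}"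
    using es(1) unfolding sum_eq by (auto simp: degree_sequences_def sum_list_sum_nth atLeast0LessThan)
  from ex_height_cdf_less[OF this, of "Suc i"] i
  show "\<exists>h. list_cdf d h < list_cdf d' h"
    unfolding cdf cdf' by (simp add: deg_def)
qed

text \<open>The chain is unrolled from the side of \<open>d\<close>. Strictness is gained in the
  first step, where the assumption on \<open>d\<close> applies, and weak inequalities carry it
  through the others; later sequences may have fewer non-leaves.\<close>

lemma list_cdf_degree_prec:
  assumes d: "d \<in> degree_sequences n" and prec: "d' \<prec>\<^sub>1 d"
  shows "list_cdf d h \<le> list_cdf d' h"
    and "3 \<le> card {i. i < n \<and> d ! i \<noteq> 0} \<Longrightarrow> \<exists>h. list_cdf d h < list_cdf d' h"
proof -
  have n: "length d = n" using d by (simp add: degree_sequences_def)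
  have "(\<forall>h. list_cdf d h \<le> list_cdf d' h) \<and>
      (3 \<le> card {i. i < n \<and> d ! i \<noteq> 0} \<longrightarrow> (\<exists>h. list_cdf d h < list_cdf d' h))"
    if "(D, D') \<in> (cover_rel n)\<^sup>+" "d \<in> D" "d' \<in> D'" for D D' and d d' :: "nat list"
    using that
  proof (induction arbitrary: d rule: converse_trancl_induct)
    case (base C)
    then show ?case using list_cdf_cover by blast
  next
    case (step C E)
    then have "E \<noteq> {}" by (auto simp: cover_rel_def covers_def)
    then obtain e where e: "e \<in> E" by blast
    note le = step.IH[OF e \<open>d' \<in> D'\<close>, THEN conjunct1, rule_format]
    note C = list_cdf_cover[OF step.hyps(1) \<open>d \<in> C\<close> e]
    show ?case
      using C le by (meson order_trans less_le_trans)
  qed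
  with prec n show "list_cdf d h \<le> list_cdf d' h"
    and "3 \<le> card {i. i < n \<and> d ! i \<noteq> 0} \<Longrightarrow> \<exists>h. list_cdf d h < list_cdf d' h"
    unfolding degree_prec_def by blast+
qed

section \<open>From counting to random trees\<close>

lemma finite_degree_trees:
  assumes "d \<in> degree_sequences n"
  shows "finite (degree_trees d)"
  using bij_betw_finite[OF bij_betw_tree_graph[OF assms]] finite_parent_trees by blast

text \<open>Heights are natural numbers, so only the integer part of \<open>t\<close> matters.
  Negative \<open>t\<close> is separate because \<open>nat\<close> would send its floor to 0, where
  the distribution function may be positive.\<close>

lemma height_cdf_uniform:
  assumes d: "d \<in> degree_sequences n" and T: "uniform_random_element M T (degree_trees d)"
  shows "measure M {w \<in> space M. real (tree_height (T w)) \<le> t} = (if t < 0 then 0 else list_cdf d (nat \<lfloor>t\<rfloor>))"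
proof -
  let ?A = "degree_trees d"
  have meas: "T \<in> measurable M (count_space ?A)" and distr: "distr M (count_space ?A) T = uniform_count_measure ?A"
    using T by (auto simp: uniform_random_element_def)
  have len: "length d = n" using d by (simp add: degree_sequences_def)
  let ?S = "{g \<in> ?A. real (tree_height g) \<le> t}"
  have "{w \<in> space M. real (tree_height (T w)) \<le> t} = T -` ?S \<inter> space M"
    using measurable_space[OF meas] by auto
  then have "measure M {w \<in> space M. real (tree_height (T w)) \<le> t} = measure (distr M (count_space ?A) T) ?S"
    using meas by (simp add: measure_distr)
  also have "\<dots> = card ?S / card ?A"
    unfolding distr by (rule measure_uniform_count_measure[OF finite_degree_trees[OF d]]) auto
  also have "\<dots> = (if t < 0 then 0 else list_cdf d (nat \<lfloor>t\<rfloor>))"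
  proof (cases "t < 0")
    case True
    then have "?S = {}" by auto
    then show ?thesis using True by (simp only: card.empty) simp
  next
    case False
    then have "real k \<le> t \<longleftrightarrow> k \<le> nat \<lfloor>t\<rfloor>" for k
      by (simp add: le_nat_iff le_floor_iff)
    then have "card ?S = card (low_trees {1..n} (\<lambda>i. d ! (i - 1)) (nat \<lfloor>t\<rfloor>))"
      using card_degree_trees_height_le[OF d] by simp
    moreover have "card ?A = card (parent_trees {1..n} (\<lambda>i. d ! (i - 1)))"
      by (rule bij_betw_same_card[OF bij_betw_tree_graph[OF d], symmetric])
    ultimately show ?thesis
      using False by (simp add: list_cdf_def height_cdf_def len)
  qed
  finally show ?thesis .
qed

theorem theorem9:
  fixes n :: nat and d d' :: "nat list"
    and M :: "'v measure" and M' :: "'w measure"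
    and T :: "'v \<Rightarrow> nat rooted_graph" and T' :: "'w \<Rightarrow> nat rooted_graph"
  assumes "d \<in> degree_sequences n" and "d' \<in> degree_sequences n"
    and "uniform_random_element M T (degree_trees d)"
    and "uniform_random_element M' T' (degree_trees d')"
    and "d' \<prec>\<^sub>1 d"
  shows "stoch_le M' (\<lambda>x. real (tree_height (T' x))) M (\<lambda>x. real (tree_height (T x))) \<and>
    (3 \<le> card {i. i < n \<and> d ! i \<noteq> 0} \<longrightarrow>
       stoch_less M' (\<lambda>x. real (tree_height (T' x))) M (\<lambda>x. real (tree_height (T x))))"
proof -
  let ?X' = "\<lambda>x. real (tree_height (T' x))" and ?X = "\<lambda>x. real (tree_height (T x))"
  note cdf = height_cdf_uniform[OF assms(1,3)] and cdf' = height_cdf_uniform[OF assms(2,4)]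
  note prec = list_cdf_degree_prec[OF assms(1,5)]
  have le: "stoch_le M' ?X' M ?X"
    unfolding stoch_le_def cdf cdf' using prec(1) by simp
  have distr_le: "measure (distr N borel (\<lambda>x. real (tree_height (S x)))) {..t} =
      measure N {x \<in> space N. real (tree_height (S x)) \<le> t}"
    if "uniform_random_element N S A" for N :: "'z measure" and S A t
  proof -
    have "S \<in> measurable N (count_space A)"
      using that by (simp add: uniform_random_element_def)
    then have "(\<lambda>x. real (tree_height (S x))) \<in> borel_measurable N"
      by (rule measurable_compose) simp
    then show ?thesis
      by (simp add: measure_distr vimage_def Int_def conj_commute)
  qed
  \<comment> \<open>At a level \<open>h\<close> with a strict gap the two distributions give
    different mass to \<open>{..real h}\<close>.\<close>
  have "distr M' borel ?X' \<noteq> distr M borel ?X" if three: "3 \<le> card {i. i < n \<and> d ! i \<noteq> 0}"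
  proof
    assume eq: "distr M' borel ?X' = distr M borel ?X"
    obtain h where h: "list_cdf d h < list_cdf d' h"
      using prec(2)[OF three] by blast
    have "measure (distr M borel ?X) {..real h} = list_cdf d h"
      unfolding distr_le[OF assms(3)] cdf by simp
    moreover have "measure (distr M' borel ?X') {..real h} = list_cdf d' h"
      unfolding distr_le[OF assms(4)] cdf' by simp
    ultimately show False using h eq by simp
  qed
  with le show ?thesis by (simp add: stoch_less_def)
qed

end
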